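(* Let $\mathcal R\subset\mathcal O=\mathbb F[[z]]$ be the ring of an irreducible plane curve singularity over a field $\mathbb F$ with reduced equation $F(x,y)$. If $\mathbb F$ has positive characteristic $\chi$, assume that $\gcd(\chi,n_1n_2\cdots n_g)=1$. Let $J\subset\mathcal A=\mathbb F[[x,y]]$ be the ideal generated by the generalized monomials in a complete system of semiroots (including $y,x$) whose $z$-valuations are at least $2\delta$, $\delta=\dim_{\mathbb F}\mathcal O/\mathcal R$. Then $F\in J$. Thus it suffices to pick, for each $k=2\delta,\ldots,2\delta+\nu(y)-1$, one generalized monomial $f_k$ with $\nu(f_k)=k$; the elements $f_k$ generate $J$.
   Context: $\mathcal R$ is the image of $\mathcal A=\mathbb F[[x,y]]$ in $\mathbb F[[z]]$ under $x\mapsto x(z)$, $y\mapsto y(z)$ with $x(z),y(z)\in z\mathbb F[[z]]$ and fraction field of $\mathcal R$ equal to $\mathbb F((z))$; $F$ is a generator of the kernel, normalized as a monic Weierstrass polynomial in $x$ over $\mathbb F[[y]]$. $\nu$ is the $z$-order of the image in $\mathbb F[[z]]$. Standard data: $\beta_0=\nu(y)<\beta_1=\nu(x)<\beta_2<\cdots<\beta_g$ are the characteristic generators of the value semigroup $\Gamma=\{\nu(f):f\in\mathcal R\setminus 0\}=\langle\beta_0,\ldots,\beta_g\rangle$; $e_i=\gcd(\beta_0,\ldots,\beta_i)$, $e_g=1$, $n_i=e_{i-1}/e_i>1$ for $1\le i\le g$; one has $\beta_{i+1}>n_i\beta_i$ and $2\delta=\sum_{i=1}^g(n_i-1)\beta_i-\beta_0+1$.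 A complete system of semiroots is $f_0=y,\ f_1=x,\ f_2,\ldots,f_g$, where for $i\ge1$ the element $f_i\in\mathbb F[[y]][x]$ is monic in $x$ of degree $n_1\cdots n_{i-1}$ with $\nu(f_i)=\beta_i$. Generalized monomials are the products $f_0^{c_0}f_1^{c_1}\cdots f_g^{c_g}$ with $c_i\ge0$. *)

theory Defs
  imports "HOL-Computational_Algebra.Computational_Algebra"
begin

text \<open>
  Encoding: \<open>\<bbbF>[[x,y]]\<close> is \<open>'a fps fps\<close>, read as \<open>\<bbbF>[[y]][[x]]\<close>: the outer variable is \<open>x\<close>, the
  coefficients are power series in \<open>y\<close>.  Likewise \<open>\<bbbF>[[y]][x]\<close> is \<open>'a fps poly\<close>; it is embedded into
  \<open>\<bbbF>[[x,y]]\<close> by \<^const>\<open>fps_of_poly\<close>.  The rings \<open>\<bbbF>[[z]]\<close> and \<open>\<bbbF>((z))\<close> are \<open>'a fps\<close> and \<open>'a fls\<close>.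
\<close>

text \<open>
  The substitution \<open>x \<mapsto> X(z)\<close>, \<open>y \<mapsto> Y(z)\<close>, i.e. \<open>\<Sum>\<^sub>i a\<^sub>i(y) x\<^sup>i \<mapsto> \<Sum>\<^sub>i a\<^sub>i(Y(z)) X(z)\<^sup>i\<close>.
  It is meant for series \<open>X\<close>, \<open>Y\<close> without constant term; then the terms with \<open>i > n\<close> do not
  contribute to the coefficient of \<open>z\<^sup>n\<close>.
\<close>
definition subst_xy :: "'a::field fps \<Rightarrow> 'a fps \<Rightarrow> 'a fps fps \<Rightarrow> 'a fps" where
  "subst_xy X Y f = Abs_fps (\<lambda>n. fps_nth (\<Sum>i\<le>n. (fps_nth f i oo Y) * X ^ i) n)"

definition branch_ring :: "'a::field fps \<Rightarrow> 'a fps \<Rightarrow> 'a fps set" where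
  "branch_ring X Y = range (subst_xy X Y)"

text \<open>
  The fraction field of \<open>R \<subseteq> \<bbbF>[[z]]\<close>, formed inside \<open>\<bbbF>((z))\<close>.
\<close>
definition fraction_field_of :: "'a::field fps set \<Rightarrow> 'a fls set" where
  "fraction_field_of R = {fps_to_fls p / fps_to_fls q | p q. p \<in> R \<and> q \<in> R \<and> q \<noteq> 0}"

text \<open>
  Beware that \<open>nu X Y f = 0\<close> if \<open>f\<close> is mapped to \<open>0\<close>, since \<open>subdegree 0 = 0\<close>.
\<close>
definition nu :: "'a::field fps \<Rightarrow> 'a fps \<Rightarrow> 'a fps fps \<Rightarrow> nat" where
  "nu X Y f = subdegree (subst_xy X Y f)"

definition value_semigroup :: "'a::field fps set \<Rightarrow> nat set" where
  "value_semigroup R = subdegree ` (R - {0})"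

definition monic_weierstrass :: "'a::field fps poly \<Rightarrow> bool" where
  "monic_weierstrass P \<longleftrightarrow> lead_coeff P = 1 \<and> (\<forall>i<degree P. fps_nth (coeff P i) 0 = 0)"

text \<open>
  The residue classes of the elements of \<open>B\<close> are pairwise distinct and form a finite \<open>\<bbbF>\<close>-basis of
  the quotient space \<open>\<bbbF>[[z]]/R\<close>, where \<open>R\<close> is an \<open>\<bbbF>\<close>-subspace.
\<close>
definition quotient_basis :: "'a::field fps set \<Rightarrow> 'a fps set \<Rightarrow> bool" where
  "quotient_basis R B \<longleftrightarrow> finite B \<and>
     (\<forall>h. \<exists>!c. (\<forall>b. b \<notin> B \<longrightarrow> c b = 0) \<and> h - (\<Sum>b\<in>B. fps_const (c b) * b) \<in> R)"

text \<open>
  \<open>dim (\<bbbF>[[z]]/R)\<close>; unspecified if the quotient is infinite-dimensional.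
\<close>
definition delta :: "'a::field fps set \<Rightarrow> nat" where
  "delta R = (THE d. \<exists>B. quotient_basis R B \<and> card B = d)"

definition char_e :: "(nat \<Rightarrow> nat) \<Rightarrow> nat \<Rightarrow> nat" where
  "char_e \<beta> i = Gcd (\<beta> ` {..i})"

text \<open>Only meaningful for \<open>i \<ge> 1\<close>.\<close>
definition char_n :: "(nat \<Rightarrow> nat) \<Rightarrow> nat \<Rightarrow> nat" where
  "char_n \<beta> i = char_e \<beta> (i - 1) div char_e \<beta> i"

text \<open>
  These conditions determine \<open>g\<close> and \<open>\<beta>\<^sub>0, \<dots>, \<beta>\<^sub>g\<close> uniquely: \<open>\<beta>\<^sub>0\<close> is the least positive element of
  \<open>\<Gamma>\<close>, and \<open>\<beta>\<^sub>i\<close> is the least element of \<open>\<Gamma>\<close> that is not divisible by \<open>e\<^sub>i\<^sub>-\<^sub>1\<close>.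
\<close>
definition characteristic_generators :: "nat set \<Rightarrow> nat \<Rightarrow> (nat \<Rightarrow> nat) \<Rightarrow> bool" where
  "characteristic_generators \<Gamma> g \<beta> \<longleftrightarrow>
     strict_mono_on {..g} \<beta> \<and>
     \<Gamma> = range (\<lambda>c :: nat \<Rightarrow> nat. \<Sum>i\<le>g. c i * \<beta> i) \<and>
     char_e \<beta> g = 1 \<and>
     (\<forall>i\<in>{1..g}. char_n \<beta> i > 1)"

definition semiroot_system ::
  "'a::field fps \<Rightarrow> 'a fps \<Rightarrow> nat \<Rightarrow> (nat \<Rightarrow> nat) \<Rightarrow> (nat \<Rightarrow> 'a fps poly) \<Rightarrow> bool" where
  "semiroot_system X Y g \<beta> f \<longleftrightarrow>
     f 0 = [:fps_X:] \<and> f 1 = [:0, 1:] \<and>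
     (\<forall>i\<in>{1..g}. lead_coeff (f i) = 1 \<and> degree (f i) = (\<Prod>j\<in>{1..<i}. char_n \<beta> j) \<and>
        nu X Y (fps_of_poly (f i)) = \<beta> i)"

definition gen_monomials :: "nat \<Rightarrow> (nat \<Rightarrow> 'a::field fps poly) \<Rightarrow> 'a fps fps set" where
  "gen_monomials g f = range (\<lambda>c :: nat \<Rightarrow> nat. \<Prod>i\<le>g. fps_of_poly (f i) ^ c i)"

definition ideal_gen :: "'b::comm_ring_1 set \<Rightarrow> 'b set" where
  "ideal_gen S = module.span (*) S"

end

theory Submission
  imports Defs "HOL-Library.Function_Algebras"
begin

text \<open>
  The products \<open>P\<^sub>r\<close> of the semiroots \<open>f\<^sub>1, \<dots>, f\<^sub>g\<close> with exponents \<open>c\<^sub>i < n\<^sub>i\<close> are monic of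
  the degrees \<open>r = 0, \<dots>, \<beta>\<^sub>0 - 1\<close>, and their values are pairwise incongruent modulo
  \<open>\<beta>\<^sub>0 = \<nu>(y)\<close>; so no cancellation of orders occurs in a combination \<open>\<Sum> a\<^sub>r(y) P\<^sub>r\<close>.  These
  values form the Apery set of \<open>\<Gamma>\<close>, which is symmetric, whence \<open>2\<delta>\<close> is the conductor.

  Put \<open>f\<^sub>g\<^sub>+\<^sub>1 = F\<close>.  In \<open>f\<^sub>j\<^sub>+\<^sub>1 = f\<^sub>j\<^bsup>n\<^sub>j\<^esup> + \<Sum> a\<^sub>r(y) P\<^sub>r\<close> all terms have value at least \<open>n\<^sub>j \<beta>\<^sub>j\<close>, and
  every \<open>a\<^sub>r\<close> is divisible by \<open>y\<close>.  Substituting the relation for \<open>f\<^sub>g\<close> into one factor of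
  \<open>f\<^sub>g\<^bsup>n\<^sub>g\<^esup>\<close>, then the one for \<open>f\<^sub>g\<^sub>-\<^sub>1\<close>, and so on down to \<open>f\<^sub>1 = x\<close>, writes \<open>F\<close> as a combination of
  generalized monomials of value at least \<open>2\<delta>\<close> with coefficients in the maximal ideal \<open>\<mm>\<close>.
  On the other hand, by successive approximation, every generalized monomial of value at least
  \<open>2\<delta>\<close> lies in \<open>J' + (F)\<close>, where \<open>J'\<close> is generated by one monomial for each of the \<open>\<beta>\<^sub>0\<close> values.
  Hence \<open>F \<in> J' + \<mm> F\<close>, so \<open>F \<in> J'\<close> and \<open>J' = J\<close>.
\<close>

subsection \<open>Characteristic sequences\<close>

locale char_seq =
  fixes g :: nat and \<beta> :: "nat \<Rightarrow> nat"
  assumes g_pos: "g \<ge> 1"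
    and char_e_last: "char_e \<beta> g = 1"
    and char_n_gt_1: "\<And>i. i \<in> {1..g} \<Longrightarrow> char_n \<beta> i > 1"
begin

abbreviation "e \<equiv> char_e \<beta>"
abbreviation "n \<equiv> char_n \<beta>"

definition d :: "nat \<Rightarrow> nat" where "d i = (\<Prod>j\<in>{1..<i}. n j)"

text \<open>
  The digits of \<open>r = \<Sum>\<^sub>i c\<^sub>i d\<^sub>i\<close>, \<open>0 \<le> c\<^sub>i < n\<^sub>i\<close>.  As \<open>d\<^sub>i\<close> is the degree of \<open>f\<^sub>i\<close>, they are the
  exponents of a product of semiroots of degree \<open>r\<close>, and \<open>w r\<close> is its value.
\<close>
definition digit :: "nat \<Rightarrow> nat \<Rightarrow> nat" where "digit r i = (r div d i) mod n i"

definition w :: "nat \<Rightarrow> nat" where "w r = (\<Sum>i\<in>{1..g}. digit r i * \<beta> i)"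

text \<open>The largest \<open>w r\<close> with \<open>r < \<beta> 0\<close>, attained when every
  digit is maximal. Subtracting \<open>\<beta> 0\<close> from it will give the Frobenius number of
  the semigroup.\<close>

definition \<sigma> :: nat where "\<sigma> = (\<Sum>i\<in>{1..g}. (n i - 1) * \<beta> i)"

text \<open>Built from digits alone, so that symmetry and the gap count are pure arithmetic. Its
  equality with the value semigroup needs the relations between semiroots.\<close>

definition Apery_hull :: "nat set" where
  "Apery_hull = {k * \<beta> 0 + w r | k r. r < \<beta> 0}"

section \<open>Divisibility and degrees along the gcd sequence\<close>

lemma e_0 [simp]: "e 0 = \<beta> 0"
  by (simp add: char_e_def)

lemma e_Suc: "e (Suc i) = gcd (\<beta> (Suc i)) (e i)"
  by (simp add: char_e_def atMost_Suc)

lemma e_dvd_beta: "k \<le> i \<Longrightarrow> e i dvd \<beta> k"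
  by (auto simp: char_e_def)

lemma e_mult:
  assumes "i \<in> {1..g}"
  shows "e (i - 1) = n i * e i"
proof -
  have "e i dvd e (i - 1)"
    using assms e_Suc[of "i - 1"] by simp
  thus ?thesis by (simp add: char_n_def)
qed

lemma n_pos: "i \<in> {1..g} \<Longrightarrow> n i > 0"
  using char_n_gt_1[of i] by simp

lemma d_1 [simp]: "d (Suc 0) = 1"
  by (simp add: d_def)

lemma d_Suc: "i \<ge> 1 \<Longrightarrow> d (Suc i) = d i * n i"
  by (simp add: d_def)

lemma d_pos: "i \<le> Suc g \<Longrightarrow> d i > 0"
  unfolding d_def by (rule prod_pos) (use n_pos in auto)

text \<open>The product of the quotients \<open>n k = e (k - 1) / e k\<close> telescopes.\<close>

lemma d_Suc_mult_e: "i \<le> g \<Longrightarrow> d (Suc i) * e i = \<beta> 0"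
proof (induction i)
  case (Suc i)
  thus ?case using e_mult[of "Suc i"] d_Suc[of "Suc i"] by (simp add: algebra_simps)
qed simp

lemma d_last: "d (Suc g) = \<beta> 0"
  using d_Suc_mult_e[of g] char_e_last by simp

lemma beta_0_pos: "\<beta> 0 > 0"
  using d_pos[of "Suc g"] d_last by simp

lemma e_pos: "i \<le> g \<Longrightarrow> e i > 0"
  using d_Suc_mult_e[of i] beta_0_pos by (cases "e i = 0") auto

lemma d_mono: "1 \<le> i \<Longrightarrow> i \<le> j \<Longrightarrow> j \<le> Suc g \<Longrightarrow> d i \<le> d j"
proof (induction j)
  case (Suc j)
  show ?case
  proof (cases "i = Suc j")
    case False
    hence "d i \<le> d j" using Suc by auto
    also have "d j \<le> d j * n j" using n_pos[of j] Suc False by auto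
    also have "\<dots> = d (Suc j)" using d_Suc[of j] Suc False by simp
    finally show ?thesis .
  qed simp
qed simp

lemma d_Suc_dvd:
  assumes "i \<ge> 1" "i < j"
  shows "d i * n i dvd d j"
proof -
  have "d (Suc i) dvd d j"
    unfolding d_def by (rule prod_dvd_prod_subset) (use assms in auto)
  thus ?thesis using assms d_Suc by simp
qed

text \<open>Divisibility would give \<open>e i = e (i - 1)\<close>, that is \<open>n i = 1\<close>.
  This separates the value of a semiroot from all values built from earlier ones.\<close>

lemma beta_not_dvd:
  assumes "i \<in> {1..g}"
  shows "\<not> e (i - 1) dvd \<beta> i"
proof
  assume "e (i - 1) dvd \<beta> i"
  hence "e i = e (i - 1)"
    using assms e_Suc[of "i - 1"] by (simp add: gcd_nat.absorb2)
  thus False using e_mult[OF assms] char_n_gt_1[OF assms] e_pos[of i] assms by simp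
qed

text \<open>Division by \<open>e i\<close> makes \<open>\<beta> i\<close> and
  \<open>e (i - 1)\<close> coprime and turns the latter into \<open>n i\<close>. Integers are used
  because \<open>k\<close> may be a difference of digits.\<close>

lemma n_dvd:
  assumes "i \<in> {1..g}" and "int (e (i - 1)) dvd k * int (\<beta> i)"
  shows "int (n i) dvd k"
proof -
  obtain b where b: "\<beta> i = e i * b" using e_dvd_beta[of i i] by auto
  have ei: "e i > 0" using e_pos assms by auto
  have "e i = gcd (\<beta> i) (e (i - 1))"
    using assms e_Suc[of "i - 1"] by simp
  also have "\<dots> = e i * gcd b (n i)"
    using e_mult[OF assms(1)] b by (simp add: gcd_mult_distrib_nat mult.commute)
  finally have "e i * gcd b (n i) = e i * 1" by (simp only: mult_1_right)
  hence "gcd b (n i) = 1" using ei by (simp only: mult_cancel1) simp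
  hence "coprime b (n i)" by (simp only: coprime_iff_gcd_eq_1)
  hence cop: "coprime (int (n i)) (int b)"
    by (simp add: coprime_commute)
  have "int (e i) * int (n i) dvd int (e i) * (k * int b)"
    using assms(2) e_mult[OF assms(1)] b by (simp add: algebra_simps)
  hence "int (n i) dvd k * int b" using ei by simp
  thus ?thesis using cop by (simp add: coprime_dvd_mult_left_iff)
qed

section \<open>Mixed-radix digits\<close>

lemma digit_eq_0: "r < d i \<Longrightarrow> digit r i = 0"
  by (simp add: digit_def)

lemma add_mult_d_less:
  assumes "j \<in> {1..g}" "r < d j" "k < n j"
  shows "r + k * d j < d (Suc j)"
proof -
  have "r + k * d j < d j * Suc k" using assms by simp
  also have "\<dots> \<le> d j * n j" using assms by (intro mult_le_mono2) simp
  finally show ?thesis using assms d_Suc by simp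
qed

text \<open>For \<open>i < j\<close> the added number is a multiple of \<open>d i * n i\<close>,
  invisible to digit \<open>i\<close>; for \<open>i > j\<close> both numbers stay below
  \<open>d i\<close>.\<close>

lemma digit_add:
  assumes "j \<in> {1..g}" "r < d j" "k < n j" "i \<in> {1..g}"
  shows "digit (r + k * d j) i = (if i = j then k else digit r i)"
proof -
  consider "i < j" | "i = j" | "i > j" by linarith
  thus ?thesis
  proof cases
    case 1
    then obtain m where m: "d j = d i * n i * m"
      using d_Suc_dvd[of i j] assms by auto
    have "d i > 0" using d_pos assms by auto
    hence "(r + d i * (n i * (m * k))) div d i = n i * (m * k) + r div d i"
      by (intro div_mult_self2) simp
    moreover have "r + k * d j = r + d i * (n i * (m * k))"
      by (simp only: m mult.assoc mult.commute[of k] mult.left_commute[of k])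
    ultimately have "(r + k * d j) div d i = n i * (m * k) + r div d i"
      by (simp only:)
    thus ?thesis using 1 by (simp add: digit_def)
  next
    case 2
    thus ?thesis using assms d_pos[of j] by (simp add: digit_def)
  next
    case 3
    have "d (Suc j) \<le> d i" using 3 assms d_mono[of "Suc j" i] by auto
    hence "r + k * d j < d i" using add_mult_d_less[OF assms(1-3)] by simp
    thus ?thesis using 3 digit_eq_0[of "r + k * d j" i] digit_eq_0[of r i] by simp
  qed
qed

text \<open>Appends one leading digit at a time, so that a product of semiroots can be built up by
  single factors \<open>f i ^ k\<close>.\<close>

lemma digit_induct [consumes 2, case_names zero step]:
  assumes "r < d (Suc j)" "j \<le> g"
    and "Q 0"
    and "\<And>i r k. i \<in> {1..j} \<Longrightarrow> r < d i \<Longrightarrow> k < n i \<Longrightarrow> Q r \<Longrightarrow> Q (r + k * d i)"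
  shows "Q r"
  using assms(1,2,4)
proof (induction j arbitrary: r)
  case 0
  thus ?case using assms(3) by simp
next
  case (Suc j)
  let ?i = "Suc j"
  have pos: "d ?i > 0" using d_pos[of ?i] Suc.prems by simp
  have "r mod d ?i < d (Suc j)" using pos by simp
  hence "Q (r mod d ?i)" using Suc.IH Suc.prems by auto
  moreover have "r div d ?i < n ?i"
    using Suc.prems d_Suc[of ?i] by (simp add: less_mult_imp_div_less mult.commute)
  ultimately have "Q (r mod d ?i + r div d ?i * d ?i)"
    using Suc.prems pos by auto
  thus ?case by (simp only: mod_div_mult_eq)
qed

section \<open>Values attached to digit expansions\<close>

lemma w_0 [simp]: "w 0 = 0"
  by (simp add: w_def digit_def)

lemma w_add:
  assumes "j \<in> {1..g}" "r < d j" "k < n j"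
  shows "w (r + k * d j) = w r + k * \<beta> j"
proof -
  have "w (r + k * d j) = (\<Sum>i\<in>{1..g}. digit r i * \<beta> i + (if i = j then k * \<beta> j else 0))"
    unfolding w_def by (rule sum.cong) (use assms digit_add digit_eq_0 in auto)
  also have "\<dots> = w r + k * \<beta> j"
    using assms by (simp add: sum.distrib w_def)
  finally show ?thesis .
qed

lemma w_eq_sum_lessThan:
  assumes "r < d j" "j \<in> {1..Suc g}"
  shows "w r = (\<Sum>i\<in>{1..<j}. digit r i * \<beta> i)"
  unfolding w_def
proof (rule sum.mono_neutral_right)
  show "\<forall>i\<in>{1..g} - {1..<j}. digit r i * \<beta> i = 0"
  proof
    fix i assume "i \<in> {1..g} - {1..<j}"
    hence "d j \<le> d i" using assms d_mono[of j i] by auto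
    thus "digit r i * \<beta> i = 0" using assms digit_eq_0[of r i] by simp
  qed
qed (use assms in auto)

lemma e_dvd_w:
  assumes "r < d (Suc j)" "j \<le> g"
  shows "e j dvd w r"
proof -
  have "e j dvd (\<Sum>i\<in>{1..<Suc j}. digit r i * \<beta> i)"
    by (intro dvd_sum dvd_mult e_dvd_beta) simp
  thus ?thesis using w_eq_sum_lessThan[OF assms(1)] assms(2) by simp
qed

text \<open>All contributions below the leading digit are divisible by \<open>e (j - 1)\<close>, so
  \<open>n_dvd\<close> forces the leading digits to agree; induction handles the rest.\<close>

lemma w_inj_mod:
  assumes "r < d (Suc j)" "s < d (Suc j)" "j \<le> g" "int (\<beta> 0) dvd int (w r) - int (w s)"
  shows "r = s"
  using assms
proof (induction j arbitrary: r s)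
  case (Suc j)
  let ?i = "Suc j"
  define r0 k s0 l where "r0 = r mod d ?i" "k = r div d ?i" "s0 = s mod d ?i" "l = s div d ?i"
  have i: "?i \<in> {1..g}" using Suc.prems by simp
  have pos: "d ?i > 0" using d_pos[of ?i] Suc.prems by simp
  have lt: "r0 < d ?i" "s0 < d ?i" "k < n ?i" "l < n ?i"
    using pos Suc.prems d_Suc[of ?i]
    by (simp_all add: r0_k_s0_l_def less_mult_imp_div_less mult.commute)
  have rs: "r = r0 + k * d ?i" "s = s0 + l * d ?i"
    by (simp_all only: r0_k_s0_l_def mod_div_mult_eq)
  have w: "w r = w r0 + k * \<beta> ?i" "w s = w s0 + l * \<beta> ?i"
    using w_add[OF i] lt rs by simp_all
  have "int (e j) dvd int (w r) - int (w s)"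
    using Suc.prems(3,4) e_dvd_beta[of 0 j] by (meson dvd_trans int_dvd_int_iff le0)
  moreover have "int (e j) dvd int (w r0) - int (w s0)"
    using e_dvd_w lt Suc.prems(3) by (intro dvd_diff) auto
  ultimately have "int (e j) dvd (int (w r) - int (w s)) - (int (w r0) - int (w s0))"
    by (rule dvd_diff)
  also have "\<dots> = (int k - int l) * int (\<beta> ?i)" by (simp add: w algebra_simps)
  finally have "int (n ?i) dvd int k - int l" using n_dvd[OF i] by simp
  hence "k = l" using lt(3,4)
    using dvd_imp_le_int[of "int k - int l" "int (n ?i)"] by (cases "k = l") auto
  hence "int (\<beta> 0) dvd int (w r0) - int (w s0)"
    using Suc.prems(4) w by simp
  hence "r0 = s0" using Suc.IH lt Suc.prems(3) by simp
  thus ?case using rs \<open>k = l\<close> by metis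
next
  case 0
  thus ?case by (metis d_1 less_one)
qed

text \<open>Subtraction from \<open>d (Suc j) - 1\<close> replaces each digit \<open>k\<close> of
  index \<open>i\<close> by \<open>n i - 1 - k\<close>, without borrowing.\<close>

lemma w_complement_gen:
  assumes "r < d (Suc j)" "j \<le> g"
  shows "w r + w (d (Suc j) - 1 - r) = (\<Sum>i\<in>{1..j}. (n i - 1) * \<beta> i)"
  using assms
proof (induction j arbitrary: r)
  case (Suc j)
  let ?i = "Suc j"
  define r0 k where "r0 = r mod d ?i" "k = r div d ?i"
  have i: "?i \<in> {1..g}" using Suc.prems by simp
  have pos: "d ?i > 0" using d_pos[of ?i] Suc.prems by simp
  have lt: "r0 < d ?i" "k < n ?i"
    using pos Suc.prems d_Suc[of ?i]
    by (simp_all add: r0_k_def less_mult_imp_div_less mult.commute)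
  have r: "r = r0 + k * d ?i" by (simp only: r0_k_def mod_div_mult_eq)
  obtain k' where k': "n ?i = Suc (k + k')" using lt(2) less_iff_Suc_add by auto
  obtain r' where r': "d ?i = Suc (r0 + r')" using lt(1) less_iff_Suc_add by auto
  have "d (Suc ?i) = d ?i + (k + k') * d ?i"
    using d_Suc[of ?i] k' by (simp add: algebra_simps)
  hence compl: "d (Suc ?i) - 1 - r = (d ?i - 1 - r0) + (n ?i - 1 - k) * d ?i"
    using k' r' r by (simp add: algebra_simps)
  have "w (d (Suc ?i) - 1 - r) = w (d ?i - 1 - r0) + (n ?i - 1 - k) * \<beta> ?i"
    unfolding compl by (rule w_add[OF i]) (use pos k' in auto)
  moreover have "w r = w r0 + k * \<beta> ?i" using w_add[OF i] lt r by simp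
  moreover have "w r0 + w (d ?i - 1 - r0) = (\<Sum>i\<in>{1..j}. (n i - 1) * \<beta> i)"
    using Suc.IH lt Suc.prems by simp
  ultimately have "w r + w (d (Suc ?i) - 1 - r)
      = (\<Sum>i\<in>{1..j}. (n i - 1) * \<beta> i) + (k + (n ?i - 1 - k)) * \<beta> ?i"
    by (simp add: algebra_simps)
  thus ?case using k' by simp
qed simp

section \<open>Residue classes modulo \<open>\<beta> 0\<close>, symmetry and gaps\<close>

lemma w_complement: "r < \<beta> 0 \<Longrightarrow> w r + w (\<beta> 0 - 1 - r) = \<sigma>"
  using w_complement_gen[of r g] d_last by (simp add: \<sigma>_def)

text \<open>Pigeonhole: the \<open>\<beta> 0\<close> numbers \<open>w r\<close> are pairwise
  incongruent and so meet every class.\<close>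

lemma residue_ex:
  obtains r where "r < \<beta> 0" "int (\<beta> 0) dvd k - int (w r)"
proof -
  let ?N = "\<beta> 0"
  have "inj_on (\<lambda>r. w r mod ?N) {..<?N}"
  proof (rule inj_onI)
    fix r s assume "r \<in> {..<?N}" "s \<in> {..<?N}" and eq: "w r mod ?N = w s mod ?N"
    moreover have "int ?N dvd int (w r) - int (w s)"
      using eq by (metis mod_eq_dvd_iff zmod_int)
    ultimately show "r = s" using w_inj_mod[of r g s] d_last by simp
  qed
  moreover have "(\<lambda>r. w r mod ?N) ` {..<?N} \<subseteq> {..<?N}"
    using beta_0_pos by auto
  ultimately have "(\<lambda>r. w r mod ?N) ` {..<?N} = {..<?N}"
    by (metis endo_inj_surj finite_lessThan)
  moreover have "nat (k mod int ?N) \<in> {..<?N}"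
    using beta_0_pos by (simp add: nat_less_iff)
  ultimately have "nat (k mod int ?N) \<in> (\<lambda>r. w r mod ?N) ` {..<?N}" by simp
  then obtain r where r: "r < ?N" "nat (k mod int ?N) = w r mod ?N" by auto
  have "k mod int ?N = int (w r mod ?N)" using r(2) beta_0_pos by (simp flip: r(2))
  hence "k mod int ?N = int (w r) mod int ?N" by (simp add: zmod_int)
  hence "int ?N dvd k - int (w r)" by (simp only: mod_eq_dvd_iff)
  thus ?thesis using that r(1) by blast
qed

text \<open>A residue class contains only one \<open>w r\<close>, which is therefore its least
  element in the hull.\<close>

lemma Apery_hull_iff:
  assumes "r < \<beta> 0" "int (\<beta> 0) dvd int k - int (w r)"
  shows "k \<in> Apery_hull \<longleftrightarrow> w r \<le> k"
proof
  assume "k \<in> Apery_hull"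
  then obtain l s where s: "s < \<beta> 0" "k = l * \<beta> 0 + w s" by (auto simp: Apery_hull_def)
  have "int (\<beta> 0) dvd (int k - int (w r)) - int l * int (\<beta> 0)"
    using assms(2) by (rule dvd_diff) simp
  hence "int (\<beta> 0) dvd int (w s) - int (w r)" by (simp add: s)
  hence "s = r" using w_inj_mod[of s g r] s assms d_last by simp
  thus "w r \<le> k" using s by simp
next
  assume le: "w r \<le> k"
  hence "\<beta> 0 dvd k - w r" using assms(2) by (metis int_dvd_int_iff of_nat_diff)
  then obtain l where "k - w r = \<beta> 0 * l" by auto
  hence "k = l * \<beta> 0 + w r" using le by (metis le_add_diff_inverse2 mult.commute)
  thus "k \<in> Apery_hull" using assms(1) unfolding Apery_hull_def by blast
qed

text \<open>If \<open>k\<close> is in the class of \<open>w r\<close>, then \<open>l\<close> is in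
  that of \<open>w (\<beta> 0 - 1 - r)\<close>, and exactly one of the two reaches its class
  minimum.\<close>

lemma Apery_hull_symmetric:
  assumes "int k + int l = int \<sigma> - int (\<beta> 0)"
  shows "k \<in> Apery_hull \<longleftrightarrow> l \<notin> Apery_hull"
proof -
  obtain r where r: "r < \<beta> 0" "int (\<beta> 0) dvd int k - int (w r)" using residue_ex[of "int k"] .
  define s where "s = \<beta> 0 - 1 - r"
  have s: "s < \<beta> 0" "w r + w s = \<sigma>" using r w_complement by (auto simp: s_def)
  hence eq: "int l - int (w s) = - (int k - int (w r)) - int (\<beta> 0)" using assms by simp
  hence "int (\<beta> 0) dvd int l - int (w s)" using r(2) by (metis dvd_diff dvd_minus_iff dvd_refl)
  hence "l \<in> Apery_hull \<longleftrightarrow> w s \<le> l" using s Apery_hull_iff by blast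
  moreover have "k \<in> Apery_hull \<longleftrightarrow> w r \<le> k" using r Apery_hull_iff by blast
  moreover have "w s \<le> l \<longleftrightarrow> \<not> w r \<le> k"
  proof
    assume "w s \<le> l" thus "\<not> w r \<le> k" using eq beta_0_pos by linarith
  next
    assume "\<not> w r \<le> k"
    hence "0 < int (w r) - int k" by simp
    moreover have "int (\<beta> 0) dvd int (w r) - int k"
      using r(2) by (metis dvd_minus_iff minus_diff_eq)
    ultimately have "int (\<beta> 0) \<le> int (w r) - int k" by (intro zdvd_imp_le)
    thus "w s \<le> l" using eq by linarith
  qed
  ultimately show ?thesis by blast
qed

text \<open>No \<open>w r\<close> exceeds \<open>\<sigma>\<close>, and a smaller number in its class
  is at most \<open>w r - \<beta> 0\<close>.\<close>

lemma Apery_hull_large: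
  assumes "\<sigma> + 1 \<le> k + \<beta> 0"
  shows "k \<in> Apery_hull"
proof -
  obtain r where r: "r < \<beta> 0" "int (\<beta> 0) dvd int k - int (w r)" using residue_ex[of "int k"] .
  have "w r \<le> \<sigma>" using w_complement[OF r(1)] by simp
  hence "int (w r) - int k < int (\<beta> 0)" using assms by linarith
  moreover have "int (\<beta> 0) dvd int (w r) - int k" using r(2) by (metis dvd_minus_iff minus_diff_eq)
  ultimately have "w r \<le> k" using zdvd_imp_le[of "int (\<beta> 0)" "int (w r) - int k"] by linarith
  thus ?thesis using r Apery_hull_iff by blast
qed

text \<open>The reflection of \<open>{..<\<sigma> + 1 - \<beta> 0}\<close> exchanges gaps and
  elements.\<close>

lemma card_gaps:
  assumes "\<beta> 0 \<le> \<sigma> + 1"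
  shows "2 * card (- Apery_hull) = \<sigma> + 1 - \<beta> 0"
proof -
  let ?c = "\<sigma> + 1 - \<beta> 0"
  have sub: "- Apery_hull \<subseteq> {..<?c}"
  proof
    fix k assume "k \<in> - Apery_hull"
    hence "\<not> \<sigma> + 1 \<le> k + \<beta> 0" using Apery_hull_large by blast
    thus "k \<in> {..<?c}" by auto
  qed
  have sym: "?c - 1 - k \<in> Apery_hull \<longleftrightarrow> k \<notin> Apery_hull" if "k < ?c" for k
    by (rule Apery_hull_symmetric) (use that in auto)
  have "bij_betw (\<lambda>k. ?c - 1 - k) (- Apery_hull) ({..<?c} \<inter> Apery_hull)"
    by (rule bij_betwI[where g = "\<lambda>k. ?c - 1 - k"]) (use sub sym in auto)
  hence "card (- Apery_hull) = card ({..<?c} \<inter> Apery_hull)" by (rule bij_betw_same_card)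
  moreover have "card (- Apery_hull \<union> ({..<?c} \<inter> Apery_hull))
      = card (- Apery_hull) + card ({..<?c} \<inter> Apery_hull)"
    by (rule card_Un_disjoint) (use sub finite_subset in auto)
  moreover have "- Apery_hull \<union> ({..<?c} \<inter> Apery_hull) = {..<?c}" using sub by auto
  ultimately show ?thesis by simp
qed

text \<open>The sum telescopes. The surplus \<open>\<beta> 1\<close> later makes the coefficients of
  the semiroot relations divisible by \<open>y\<close> and carries values past the
  conductor.\<close>

lemma sum_bound:
  assumes "\<And>i. i \<in> {1..<g} \<Longrightarrow> n i * \<beta> i \<le> \<beta> (Suc i)" and "1 \<le> j" "j \<le> g"
  shows "(\<Sum>i\<in>{1..j}. (n i - 1) * \<beta> i) + \<beta> 1 \<le> n j * \<beta> j"
  using assms(2,3)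
proof (induction j rule: dec_induct)
  case base
  thus ?case using n_pos[of 1] by (cases "n 1") auto
next
  case (step j)
  have "(\<Sum>i\<in>{1..Suc j}. (n i - 1) * \<beta> i) + \<beta> 1
      \<le> n j * \<beta> j + (n (Suc j) - 1) * \<beta> (Suc j)"
    using step by simp
  also have "\<dots> \<le> \<beta> (Suc j) + (n (Suc j) - 1) * \<beta> (Suc j)" using assms(1)[of j] step by simp
  also have "\<dots> = n (Suc j) * \<beta> (Suc j)"
    using n_pos[of "Suc j"] step by (cases "n (Suc j)") auto
  finally show ?case .
qed

text \<open>Exponents are normalized from the top: the leading one is reduced modulo
  \<open>n j\<close>, and each removed block \<open>n j * \<beta> j\<close> is rewritten by
  \<open>rel\<close> through lower generators.\<close>

lemma semigroup_subset:
  assumes rel: "\<And>j. j \<in> {1..g} \<Longrightarrow> \<exists>k r. r < d j \<and> n j * \<beta> j = k * \<beta> 0 + w r"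
    and "j \<le> g"
  shows "\<exists>k r. r < d (Suc j) \<and> (\<Sum>i\<le>j. c i * \<beta> i) = k * \<beta> 0 + w r"
  using assms(2)
proof (induction j arbitrary: c)
  case 0
  show ?case by (rule exI[of _ "c 0"], rule exI[of _ 0]) simp
next
  case (Suc j)
  let ?i = "Suc j"
  have i: "?i \<in> {1..g}" using Suc by simp
  obtain k0 r0 where r0: "r0 < d ?i" "n ?i * \<beta> ?i = k0 * \<beta> 0 + w r0" using rel[OF i] by blast
  define q s where "q = c ?i div n ?i" "s = c ?i mod n ?i"
  \<comment> \<open>The \<open>q\<close> blocks \<open>n ?i * \<beta> ?i\<close> are traded for
    \<open>q\<close> copies of \<open>k0 * \<beta> 0 + w r0\<close>, which involves only generators
    of index at most \<open>j\<close>.\<close>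
  define c' where "c' = (\<lambda>i. c i + q * (if i = 0 then k0 else digit r0 i))"
  have s: "s < n ?i" "c ?i = q * n ?i + s" using n_pos[OF i] by (simp_all only: q_s_def mod_less_divisor div_mult_mod_eq)
  have "{..j} = insert 0 {1..<?i}" by auto
  hence "(\<Sum>i\<le>j. (if i = 0 then k0 else digit r0 i) * \<beta> i)
      = k0 * \<beta> 0 + (\<Sum>i\<in>{1..<?i}. (if i = 0 then k0 else digit r0 i) * \<beta> i)"
    by simp
  also have "(\<Sum>i\<in>{1..<?i}. (if i = 0 then k0 else digit r0 i) * \<beta> i) = w r0"
    using w_eq_sum_lessThan[OF r0(1)] i by simp
  finally have "(\<Sum>i\<le>j. (if i = 0 then k0 else digit r0 i) * \<beta> i) = n ?i * \<beta> ?i"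
    using r0 by simp
  hence "(\<Sum>i\<le>j. c' i * \<beta> i) = (\<Sum>i\<le>j. c i * \<beta> i) + q * (n ?i * \<beta> ?i)"
    by (simp add: c'_def sum.distrib algebra_simps flip: sum_distrib_left)
  hence eq: "(\<Sum>i\<le>?i. c i * \<beta> i) = (\<Sum>i\<le>j. c' i * \<beta> i) + s * \<beta> ?i"
    using s by (simp add: algebra_simps)
  obtain k r where r: "r < d ?i" "(\<Sum>i\<le>j. c' i * \<beta> i) = k * \<beta> 0 + w r"
    using Suc.IH[of c'] Suc.prems by auto
  show ?case
    using add_mult_d_less[OF i r(1) s(1)] w_add[OF i r(1) s(1)] eq r(2) by (metis add.assoc)
qed

lemma semigroup_eq_Apery_hull:
  assumes rel: "\<And>j. j \<in> {1..g} \<Longrightarrow> \<exists>k r. r < d j \<and> n j * \<beta> j = k * \<beta> 0 + w r"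
  shows "range (\<lambda>c :: nat \<Rightarrow> nat. \<Sum>i\<le>g. c i * \<beta> i) = Apery_hull"
proof
  show "range (\<lambda>c :: nat \<Rightarrow> nat. \<Sum>i\<le>g. c i * \<beta> i) \<subseteq> Apery_hull"
    using semigroup_subset[OF rel, of g] d_last unfolding Apery_hull_def by fastforce
  show "Apery_hull \<subseteq> range (\<lambda>c :: nat \<Rightarrow> nat. \<Sum>i\<le>g. c i * \<beta> i)"
  proof
    fix v assume "v \<in> Apery_hull"
    then obtain k r where v: "v = k * \<beta> 0 + w r" unfolding Apery_hull_def by auto
    have "{..g} = insert 0 {1..g}" by auto
    hence "(\<Sum>i\<le>g. (if i = 0 then k else digit r i) * \<beta> i)
        = k * \<beta> 0 + (\<Sum>i\<in>{1..g}. (if i = 0 then k else digit r i) * \<beta> i)"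
      by simp
    also have "(\<Sum>i\<in>{1..g}. (if i = 0 then k else digit r i) * \<beta> i) = w r"
      unfolding w_def by (rule sum.cong) auto
    finally show "v \<in> range (\<lambda>c :: nat \<Rightarrow> nat. \<Sum>i\<le>g. c i * \<beta> i)"
      using v by (intro image_eqI[of _ _ "\<lambda>i. if i = 0 then k else digit r i"]) simp_all
  qed
qed

end

subsection \<open>Ideals\<close>

lemma ideal_gen_base: "a \<in> S \<Longrightarrow> a \<in> ideal_gen (S :: 'b::comm_ring_1 set)"
proof -
  interpret module "(*) :: 'b \<Rightarrow> 'b \<Rightarrow> 'b" by unfold_locales (simp_all add: algebra_simps)
  show "a \<in> S \<Longrightarrow> a \<in> ideal_gen S" by (simp add: ideal_gen_def span_base)
qed

lemma ideal_gen_0: "0 \<in> ideal_gen (S :: 'b::comm_ring_1 set)"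
proof -
  interpret module "(*) :: 'b \<Rightarrow> 'b \<Rightarrow> 'b" by unfold_locales (simp_all add: algebra_simps)
  show ?thesis by (simp add: ideal_gen_def span_zero)
qed

lemma ideal_gen_add:
  "a \<in> ideal_gen S \<Longrightarrow> b \<in> ideal_gen S \<Longrightarrow> a + b \<in> ideal_gen (S :: 'b::comm_ring_1 set)"
proof -
  interpret module "(*) :: 'b \<Rightarrow> 'b \<Rightarrow> 'b" by unfold_locales (simp_all add: algebra_simps)
  show "a \<in> ideal_gen S \<Longrightarrow> b \<in> ideal_gen S \<Longrightarrow> a + b \<in> ideal_gen S"
    by (simp add: ideal_gen_def span_add)
qed

lemma ideal_gen_mult: "a \<in> ideal_gen S \<Longrightarrow> c * a \<in> ideal_gen (S :: 'b::comm_ring_1 set)"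
proof -
  interpret module "(*) :: 'b \<Rightarrow> 'b \<Rightarrow> 'b" by unfold_locales (simp_all add: algebra_simps)
  show "a \<in> ideal_gen S \<Longrightarrow> c * a \<in> ideal_gen S" by (simp add: ideal_gen_def span_scale)
qed

lemma ideal_gen_subset:
  assumes "S \<subseteq> ideal_gen (T :: 'b::comm_ring_1 set)"
  shows "ideal_gen S \<subseteq> ideal_gen T"
proof -
  interpret module "(*) :: 'b \<Rightarrow> 'b \<Rightarrow> 'b" by unfold_locales (simp_all add: algebra_simps)
  show ?thesis using assms by (simp add: ideal_gen_def span_minimal)
qed

lemma ideal_gen_sum:
  "(\<And>i. i \<in> A \<Longrightarrow> h i \<in> ideal_gen S) \<Longrightarrow> sum h A \<in> ideal_gen (S :: 'b::comm_ring_1 set)"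
  by (induction A rule: infinite_finite_induct) (simp_all add: ideal_gen_0 ideal_gen_add)

lemma ideal_gen_singleton: "a \<in> ideal_gen {b :: 'b::comm_ring_1} \<longleftrightarrow> b dvd a"
proof -
  interpret module "(*) :: 'b \<Rightarrow> 'b \<Rightarrow> 'b" by unfold_locales (simp_all add: algebra_simps)
  show ?thesis by (auto simp: ideal_gen_def span_singleton dvd_def mult.commute)
qed

lemma sum_fun_apply: "sum h A x = (\<Sum>i\<in>A. h i x)"
  by (induction A rule: infinite_finite_induct) simp_all

lemma fps_const_sum: "fps_const (sum h A) = (\<Sum>i\<in>A. fps_const (h i))"
  by (induction A rule: infinite_finite_induct) (simp_all flip: fps_const_add)

subsection \<open>Codimension\<close>

locale fps_subspace =
  fixes R :: "'a::field fps set"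
  assumes zero_mem: "0 \<in> R"
    and add_mem: "p \<in> R \<Longrightarrow> q \<in> R \<Longrightarrow> p + q \<in> R"
    and scale_mem: "p \<in> R \<Longrightarrow> fps_const c * p \<in> R"
begin

lemma minus_mem: "p \<in> R \<Longrightarrow> - p \<in> R"
  using scale_mem[of p "-1"] by (simp flip: fps_const_neg)

lemma diff_mem: "p \<in> R \<Longrightarrow> q \<in> R \<Longrightarrow> p - q \<in> R"
  using add_mem[of p "-q"] minus_mem[of q] by simp

lemma sum_mem: "(\<And>i. i \<in> A \<Longrightarrow> h i \<in> R) \<Longrightarrow> sum h A \<in> R"
  by (induction A rule: infinite_finite_induct) (simp_all add: zero_mem add_mem)

text \<open>
  Taking coordinates with respect to one basis embeds the other one as a linearly independent
  family into a space of functions with finite support.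
\<close>
lemma quotient_basis_card_le:
  assumes B: "quotient_basis R B" and B': "quotient_basis R B'"
  shows "card B' \<le> card B"
proof -
  define scale :: "'a \<Rightarrow> ('a fps \<Rightarrow> 'a) \<Rightarrow> 'a fps \<Rightarrow> 'a" where "scale = (\<lambda>c f x. c * f x)"
  interpret V: vector_space scale
    by unfold_locales (auto simp: scale_def algebra_simps)
  define co where "co = (\<lambda>h c. (\<forall>b. b \<notin> B \<longrightarrow> c b = 0) \<and> h - (\<Sum>b\<in>B. fps_const (c b) * b) \<in> R)"
  define T where "T = (\<lambda>h. THE c. co h c)"
  have fin: "finite B" "finite B'" using B B' by (auto simp: quotient_basis_def)
  have ex1: "\<exists>!c. co h c" for h using B unfolding co_def quotient_basis_def by blast
  have co_T: "co h (T h)" for h unfolding T_def by (rule theI'[OF ex1])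
  have T_mem: "h - (\<Sum>b\<in>B. fps_const (T h b) * b) \<in> R" for h
    using co_T[of h] unfolding co_def by (rule conjunct2)
  \<comment> \<open>Uniqueness of the coordinates of \<open>0\<close> makes \<open>B'\<close>
    independent modulo \<open>R\<close>; coefficients are cut off outside \<open>B'\<close> to fit
    the definition.\<close>
  have uniq': "c b = 0" if "(\<Sum>b\<in>B'. fps_const (c b) * b) \<in> R" "b \<in> B'" for c b
  proof -
    let ?c = "\<lambda>b. if b \<in> B' then c b else 0"
    have "(\<Sum>b\<in>B'. fps_const (?c b) * b) = (\<Sum>b\<in>B'. fps_const (c b) * b)"
      by (rule sum.cong) auto
    hence "0 - (\<Sum>b\<in>B'. fps_const (?c b) * b) \<in> R" using minus_mem[OF that(1)] by simp
    moreover have "0 - (\<Sum>b\<in>B'. fps_const 0 * b) \<in> R" using zero_mem by simp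
    moreover have "\<exists>!c. (\<forall>b. b \<notin> B' \<longrightarrow> c b = 0) \<and> 0 - (\<Sum>b\<in>B'. fps_const (c b) * b) \<in> R"
      using B' unfolding quotient_basis_def by blast
    ultimately have "?c = (\<lambda>_. 0)" by auto
    thus ?thesis using that(2) by (metis (full_types))
  qed
  have inj: "inj_on T B'"
  proof (rule inj_onI, rule ccontr)
    fix a b assume ab: "a \<in> B'" "b \<in> B'" "T a = T b" "a \<noteq> b"
    have "(a - (\<Sum>x\<in>B. fps_const (T a x) * x)) - (b - (\<Sum>x\<in>B. fps_const (T b x) * x)) \<in> R"
      by (rule diff_mem[OF T_mem T_mem])
    hence "a - b \<in> R" using ab by simp
    \<comment> \<open>The coefficients \<open>1\<close> and \<open>-1\<close> turn
      \<open>a - b \<in> R\<close> into a nontrivial relation.\<close>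
    moreover have "(\<Sum>x\<in>B'. fps_const (if x = a then 1 else if x = b then -1 else 0) * x)
        = (\<Sum>x\<in>{a, b}. fps_const (if x = a then 1 else if x = b then -1 else 0) * x)"
      by (rule sum.mono_neutral_right) (use fin ab in auto)
    ultimately have "(\<Sum>x\<in>B'. fps_const (if x = a then 1 else if x = b then -1 else 0) * x) \<in> R"
      using ab by (simp flip: fps_const_neg)
    from uniq'[OF this ab(1)] show False by simp
  qed
  have "V.independent (T ` B')"
  proof (rule V.independent_if_scalars_zero)
    fix u v assume zero: "(\<Sum>v\<in>T ` B'. scale (u v) v) = 0" and v: "v \<in> T ` B'"
    have zero': "(\<Sum>b\<in>B'. u (T b) * T b x) = 0" for x
    proof -
      have "(\<Sum>b\<in>B'. u (T b) * T b x) = (\<Sum>v\<in>T ` B'. scale (u v) v) x"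
        using inj by (simp add: sum.reindex scale_def sum_fun_apply)
      thus ?thesis using zero by simp
    qed
    \<comment> \<open>Each \<open>b\<close> differs from its coordinate combination by an element of
      \<open>R\<close>. Weighted by \<open>u\<close>, these combinations cancel, leaving a relation
      among the elements of \<open>B'\<close>.\<close>
    have "(\<Sum>b\<in>B'. fps_const (u (T b)) * (b - (\<Sum>x\<in>B. fps_const (T b x) * x))) \<in> R"
      by (intro sum_mem scale_mem T_mem)
    also have "(\<Sum>b\<in>B'. fps_const (u (T b)) * (b - (\<Sum>x\<in>B. fps_const (T b x) * x)))
        = (\<Sum>b\<in>B'. fps_const (u (T b)) * b)
          - (\<Sum>x\<in>B. \<Sum>b\<in>B'. fps_const (u (T b) * T b x) * x)"
      by (subst sum.swap)
         (simp add: sum_subtractf right_diff_distrib sum_distrib_left mult.assoc flip: fps_const_mult)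
    also have "(\<Sum>x\<in>B. \<Sum>b\<in>B'. fps_const (u (T b) * T b x) * x)
        = (\<Sum>x\<in>B. fps_const (\<Sum>b\<in>B'. u (T b) * T b x) * x)"
      by (simp add: sum_distrib_right fps_const_sum)
    also have "\<dots> = 0" by (simp only: zero') simp
    finally have "(\<Sum>b\<in>B'. fps_const (u (T b)) * b) \<in> R" by simp
    thus "u v = 0" using uniq'[of "\<lambda>b. u (T b)"] v by auto
  qed (use fin in simp)
  moreover have "T ` B' \<subseteq> V.span ((\<lambda>b x. if x = b then 1 else 0) ` B)"
  proof
    fix v assume "v \<in> T ` B'"
    then obtain h where v: "v = T h" by auto
    have "v x = (\<Sum>b\<in>B. scale (v b) (\<lambda>x. if x = b then 1 else 0)) x" for x
      using co_T[of h] fin(1) by (auto simp: co_def v sum_fun_apply scale_def if_distrib cong: if_cong)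
    hence "v = (\<Sum>b\<in>B. scale (v b) (\<lambda>x. if x = b then 1 else 0))" by blast
    also have "\<dots> \<in> V.span ((\<lambda>b x. if x = b then 1 else 0) ` B)"
      by (intro V.span_sum V.span_scale V.span_base) auto
    finally show "v \<in> V.span ((\<lambda>b x. if x = b then 1 else 0) ` B)" .
  qed
  ultimately have "card (T ` B') \<le> card ((\<lambda>b x. if x = b then 1 else 0 :: 'a) ` B)"
    using V.independent_span_bound fin by blast
  also have "\<dots> \<le> card B" using fin by (intro card_image_le)
  finally show ?thesis using inj by (simp add: card_image)
qed

lemma delta_eq_card:
  assumes "quotient_basis R B"
  shows "delta R = card B"
  unfolding delta_def
proof (rule the_equality)
  show "\<exists>B'. quotient_basis R B' \<and> card B' = card B" using assms by blast
  show "k = card B" if "\<exists>B'. quotient_basis R B' \<and> card B' = k" for k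
    using that assms quotient_basis_card_le by (metis le_antisym)
qed

text \<open>Spanning: lowest coefficients are cleared one by one, at a gap by a power of
  \<open>z\<close>, otherwise by an element of \<open>R\<close> of that order. Independence: a
  nonzero combination of gap powers has a gap as its order, so it is not in
  \<open>R\<close>.\<close>

lemma quotient_basis_gaps:
  assumes large: "\<And>h. (\<And>i. i < c \<Longrightarrow> fps_nth h i = 0) \<Longrightarrow> h \<in> R"
    and "finite (- value_semigroup R)"
  shows "quotient_basis R ((\<lambda>k. fps_X ^ k) ` (- value_semigroup R))"
proof -
  let ?G = "- value_semigroup R"
  let ?B = "(\<lambda>k. fps_X ^ k :: 'a fps) ` ?G"
  have inj: "inj_on (\<lambda>k. fps_X ^ k :: 'a fps) ?G"
    by (rule inj_on_inverseI[where g = subdegree]) (simp add: subdegree_power)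
  have sum_B: "(\<Sum>b\<in>?B. fps_const (u b) * b) = (\<Sum>k\<in>?G. fps_const (u (fps_X ^ k)) * fps_X ^ k)"
    for u :: "'a fps \<Rightarrow> 'a" using inj by (simp add: sum.reindex)
  \<comment> \<open>\<open>m\<close> counts the orders below \<open>c\<close> still to be cleared;
    for \<open>m = c\<close> the condition on \<open>h\<close> is empty.\<close>
  have "\<exists>u. h - (\<Sum>k\<in>?G. fps_const (u k) * fps_X ^ k) \<in> R"
    if "\<And>i. i < c - m \<Longrightarrow> fps_nth h i = 0" for h m
    using that
  proof (induction m arbitrary: h)
    case 0
    hence "h \<in> R" using large by simp
    thus ?case by (intro exI[of _ "\<lambda>_. 0"]) simp
  next
    case (Suc m)
    let ?l = "c - Suc m"
    show ?case
    proof (cases "?l \<in> ?G")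
      case True
      define h' where "h' = h - fps_const (fps_nth h ?l) * fps_X ^ ?l"
      have "fps_nth h' i = 0" if "i < c - m" for i
        using Suc.prems[of i] that by (cases "i = ?l") (auto simp: h'_def fps_X_power_nth)
      then obtain u where u: "h' - (\<Sum>k\<in>?G. fps_const (u k) * fps_X ^ k) \<in> R"
        using Suc.IH by blast
      have "(\<Sum>k\<in>?G. fps_const (u k + (if k = ?l then fps_nth h ?l else 0)) * fps_X ^ k)
          = (\<Sum>k\<in>?G. fps_const (u k) * fps_X ^ k + (if k = ?l then fps_const (fps_nth h ?l) * fps_X ^ ?l else 0))"
        by (rule sum.cong) (auto simp: algebra_simps simp flip: fps_const_add)
      also have "\<dots> = (\<Sum>k\<in>?G. fps_const (u k) * fps_X ^ k) + fps_const (fps_nth h ?l) * fps_X ^ ?l"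
        using True assms(2) by (simp add: sum.distrib)
      finally show ?thesis using u
        by (intro exI[of _ "\<lambda>k. u k + (if k = ?l then fps_nth h ?l else 0)"])
           (simp add: h'_def algebra_simps)
    next
      case False
      hence "?l \<in> subdegree ` (R - {0})" by (simp add: value_semigroup_def)
      then obtain p where "?l = subdegree p" "p \<in> R - {0}" by (rule imageE)
      hence p: "p \<in> R" "p \<noteq> 0" "subdegree p = ?l" by simp_all
      have pl: "fps_nth p ?l \<noteq> 0" using p by (metis nth_subdegree_nonzero)
      define q where "q = fps_const (fps_nth h ?l / fps_nth p ?l) * p"
      have q: "q \<in> R" unfolding q_def using p by (intro scale_mem)
      have "fps_nth (h - q) i = 0" if "i < c - m" for i
      proof (cases "i = ?l")
        case True
        thus ?thesis using pl by (simp add: q_def)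
      next
        case False
        hence "i < ?l" using that by linarith
        thus ?thesis using Suc.prems[of i] p nth_less_subdegree_zero[of i p] by (simp add: q_def)
      qed
      then obtain u where "(h - q) - (\<Sum>k\<in>?G. fps_const (u k) * fps_X ^ k) \<in> R"
        using Suc.IH by blast
      from add_mem[OF this q] show ?thesis by (intro exI[of _ u]) (simp add: algebra_simps)
    qed
  qed
  from this[of c] have ex: "\<exists>u. h - (\<Sum>k\<in>?G. fps_const (u k) * fps_X ^ k) \<in> R" for h by simp
  have uniq: "u k = 0" if "(\<Sum>k\<in>?G. fps_const (u k) * fps_X ^ k) \<in> R" "k \<in> ?G" for u k
  proof -
    let ?s = "\<Sum>k\<in>?G. fps_const (u k) * fps_X ^ k"
    have nth: "fps_nth ?s i = (if i \<in> ?G then u i else 0)" for i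
      using assms(2) by (simp add: fps_sum_nth fps_X_power_nth if_distrib cong: if_cong)
    have "?s = 0"
    proof (rule ccontr)
      assume nz: "?s \<noteq> 0"
      hence "subdegree ?s \<notin> ?G" using that(1) by (auto simp: value_semigroup_def)
      hence "fps_nth ?s (subdegree ?s) = 0" by (simp only: nth if_False)
      thus False using nz by simp
    qed
    thus ?thesis using nth[of k] that(2) by simp
  qed
  show ?thesis unfolding quotient_basis_def
  proof (intro conjI allI)
    show "finite ?B" using assms(2) by simp
    fix h
    obtain u where u: "h - (\<Sum>k\<in>?G. fps_const (u k) * fps_X ^ k) \<in> R" using ex by blast
    define c where "c = (\<lambda>b. if b \<in> ?B then u (subdegree b) else 0)"
    have eq: "(\<Sum>k\<in>?G. fps_const (c (fps_X ^ k)) * fps_X ^ k) = (\<Sum>k\<in>?G. fps_const (u k) * fps_X ^ k)"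
      by (rule sum.cong) (auto simp: c_def subdegree_power)
    show "\<exists>!c. (\<forall>b. b \<notin> ?B \<longrightarrow> c b = 0) \<and> h - (\<Sum>b\<in>?B. fps_const (c b) * b) \<in> R"
    proof (rule ex1I)
      show "(\<forall>b. b \<notin> ?B \<longrightarrow> c b = 0) \<and> h - (\<Sum>b\<in>?B. fps_const (c b) * b) \<in> R"
        unfolding sum_B eq using u by (auto simp: c_def)
      fix c' assume c': "(\<forall>b. b \<notin> ?B \<longrightarrow> c' b = 0) \<and> h - (\<Sum>b\<in>?B. fps_const (c' b) * b) \<in> R"
      have "(h - (\<Sum>k\<in>?G. fps_const (u k) * fps_X ^ k))
          - (h - (\<Sum>k\<in>?G. fps_const (c' (fps_X ^ k)) * fps_X ^ k)) \<in> R"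
        by (rule diff_mem[OF u conjunct2[OF c'[unfolded sum_B]]])
      hence "(\<Sum>k\<in>?G. fps_const (c' (fps_X ^ k) - u k) * fps_X ^ k) \<in> R"
        by (simp add: algebra_simps sum_subtractf flip: fps_const_sub)
      from uniq[OF this] have "c' (fps_X ^ k) = c (fps_X ^ k)" if "k \<in> ?G" for k
        using that by (simp add: c_def subdegree_power)
      moreover have "c' b = c b" if "b \<notin> ?B" for b using that c' by (simp only: c_def if_False) blast
      ultimately show "c' = c" by (metis imageE ext)
    qed
  qed
qed

end

subsection \<open>Expansions\<close>

text \<open>
  The products \<open>Y\<^sup>j p\<^sub>k\<close> have the orders \<open>c, c + 1, c + 2, \<dots>\<close>, each exactly once, so their
  coefficients can be determined successively.
\<close>
lemma fps_expansion:
  fixes Y h :: "'a::field fps" and p :: "nat \<Rightarrow> 'a fps"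
  assumes Y: "subdegree Y > 0"
    and p: "\<And>k. k < subdegree Y \<Longrightarrow> p k \<noteq> 0 \<and> subdegree (p k) = c + k"
    and h: "\<And>i. i < c \<Longrightarrow> fps_nth h i = 0"
  obtains a where "h = (\<Sum>k<subdegree Y. (a k oo Y) * p k)"
proof -
  define N where "N = subdegree Y"
  have Y0: "Y \<noteq> 0" "fps_nth Y 0 = 0" using Y by auto
  \<comment> \<open>All products in one sequence: \<open>i div N\<close> is the power of
    \<open>Y\<close> and \<open>i mod N\<close> selects the factor \<open>p\<close>.\<close>
  define t where "t = (\<lambda>i. Y ^ (i div N) * p (i mod N))"
  have pN: "p (i mod N) \<noteq> 0" "subdegree (p (i mod N)) = c + i mod N" for i
    using p[of "i mod N"] Y by (auto simp: N_def)
  have t: "t i \<noteq> 0" "subdegree (t i) = c + i" for i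
    using Y0 pN[of i] by (simp_all add: t_def N_def)
  \<comment> \<open>What is left of \<open>h\<close> after its orders below \<open>c + i\<close>
    have been cancelled.\<close>
  define rem where "rem = rec_nat h (\<lambda>i q. q - fps_const (fps_nth q (c + i) / fps_nth (t i) (c + i)) * t i)"
  define u where "u = (\<lambda>i. fps_nth (rem i) (c + i) / fps_nth (t i) (c + i))"
  have rem_Suc: "rem (Suc i) = rem i - fps_const (u i) * t i" for i
    by (simp add: rem_def u_def)
  have t_lead: "fps_nth (t i) (c + i) \<noteq> 0" for i
    using t[of i] by (metis nth_subdegree_nonzero)
  have low: "fps_nth (rem i) l = 0" if "l < c + i" for i l
    using that
  proof (induction i)
    case 0
    thus ?case using h by (simp add: rem_def)
  next
    case (Suc i)
    show ?case
    proof (cases "l = c + i")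
      case True
      thus ?thesis using t_lead[of i] by (simp add: rem_Suc u_def)
    next
      case False
      hence "l < c + i" using Suc.prems by simp
      moreover from this have "fps_nth (t i) l = 0" using t(2)[of i] by (intro nth_less_subdegree_zero) simp
      ultimately show ?thesis using Suc.IH by (simp add: rem_Suc)
    qed
  qed
  have h_rem: "h = rem i + (\<Sum>j<i. fps_const (u j) * t j)" for i
    by (induction i) (simp_all add: rem_Suc, simp add: rem_def)
  define a where "a = (\<lambda>k. Abs_fps (\<lambda>j. u (j * N + k)))"
  have "fps_nth h m = fps_nth (\<Sum>k<N. (a k oo Y) * p k) m" for m
  proof -
    \<comment> \<open>As \<open>m < J * N\<close>, the remainder after \<open>J\<close> full blocks
      does not reach coefficient \<open>m\<close>. The blocks are then resummed by residue modulo
      \<open>N\<close>.\<close>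
    define J where "J = Suc m"
    have "Suc m * 1 \<le> J * N" unfolding J_def using Y by (intro mult_le_mono) (auto simp: N_def)
    hence "m < J * N" by simp
    hence "fps_nth (rem (J * N)) m = 0" using low by simp
    hence "fps_nth h m = fps_nth (\<Sum>j<J * N. fps_const (u j) * t j) m"
      using h_rem[of "J * N"] by (metis add_0 fps_add_nth)
    also have "(\<Sum>j<J * N. fps_const (u j) * t j) = (\<Sum>j<J. \<Sum>i\<in>{j * N..<j * N + N}. fps_const (u i) * t i)"
      by (rule sum.nat_group[symmetric])
    also have "\<dots> = (\<Sum>j<J. \<Sum>k<N. fps_const (u (j * N + k)) * t (j * N + k))"
    proof (rule sum.cong[OF refl])
      fix j
      show "(\<Sum>i\<in>{j * N..<j * N + N}. fps_const (u i) * t i) = (\<Sum>k<N. fps_const (u (j * N + k)) * t (j * N + k))"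
        using sum.shift_bounds_nat_ivl[of "\<lambda>i. fps_const (u i) * t i" 0 "j * N" N]
        by (simp add: atLeast0LessThan add.commute)
    qed
    also have "\<dots> = (\<Sum>k<N. \<Sum>j<J. fps_const (u (j * N + k)) * t (j * N + k))"
      by (rule sum.swap)
    also have "\<dots> = (\<Sum>k<N. (\<Sum>j<J. fps_const (u (j * N + k)) * Y ^ j) * p k)"
      by (simp add: t_def sum_distrib_right mult.assoc)
    also have "fps_nth \<dots> m = fps_nth (\<Sum>k<N. (a k oo Y) * p k) m"
    proof -
      have "fps_nth (\<Sum>j<J. fps_const (u (j * N + k)) * Y ^ j) i = fps_nth (a k oo Y) i" if "i \<le> m" for k i
      proof -
        have "fps_nth (\<Sum>j<J. fps_const (u (j * N + k)) * Y ^ j) i = (\<Sum>j<J. u (j * N + k) * fps_nth (Y ^ j) i)"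
          by (simp add: fps_sum_nth)
        also have "\<dots> = (\<Sum>j\<in>{0..i}. u (j * N + k) * fps_nth (Y ^ j) i)"
        proof (rule sum.mono_neutral_right)
          show "\<forall>j\<in>{..<J} - {0..i}. u (j * N + k) * fps_nth (Y ^ j) i = 0"
            using startsby_zero_power_prefix[OF Y0(2)] by auto
        qed (use that in \<open>auto simp: J_def\<close>)
        also have "\<dots> = fps_nth (a k oo Y) i" by (simp add: fps_compose_nth a_def)
        finally show ?thesis .
      qed
      thus ?thesis by (simp add: fps_sum_nth fps_mult_nth)
    qed
    finally show ?thesis .
  qed
  hence "h = (\<Sum>k<N. (a k oo Y) * p k)" by (rule fps_ext)
  thus ?thesis using that by (simp add: N_def)
qed

text \<open>The nonzero term of least order is unique, so nothing cancels its leading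
  coefficient.\<close>

lemma subdegree_sum_distinct:
  fixes t :: "'i \<Rightarrow> 'a::field fps"
  assumes "finite A"
    and distinct: "\<And>i j. i \<in> A \<Longrightarrow> j \<in> A \<Longrightarrow> t i \<noteq> 0 \<Longrightarrow> t j \<noteq> 0 \<Longrightarrow>
      subdegree (t i) = subdegree (t j) \<Longrightarrow> i = j"
    and "k \<in> A" "t k \<noteq> 0"
  obtains i where "i \<in> A" "t i \<noteq> 0" "sum t A \<noteq> 0" "subdegree (sum t A) = subdegree (t i)"
    "\<And>j. j \<in> A \<Longrightarrow> t j \<noteq> 0 \<Longrightarrow> subdegree (t i) \<le> subdegree (t j)"
proof -
  obtain i where i: "i \<in> A" "t i \<noteq> 0"
    and min: "\<And>j. j \<in> A \<Longrightarrow> t j \<noteq> 0 \<Longrightarrow> subdegree (t i) \<le> subdegree (t j)"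
    using ex_has_least_nat[of "\<lambda>i. i \<in> A \<and> t i \<noteq> 0" k "\<lambda>i. subdegree (t i)"] assms(3,4) by auto
  have rest: "fps_nth (t j) l = 0" if "j \<in> A" "j \<noteq> i" "l \<le> subdegree (t i)" for j l
  proof (cases "t j = 0")
    case False
    hence "subdegree (t i) < subdegree (t j)"
      using min[of j] distinct[of i j] that i by fastforce
    thus ?thesis using that by (intro nth_less_subdegree_zero) simp
  qed simp
  have sum_nth: "fps_nth (sum t A) l = fps_nth (t i) l" if "l \<le> subdegree (t i)" for l
    using assms(1) i(1) rest that by (simp add: fps_sum_nth sum.remove)
  have nz: "fps_nth (sum t A) (subdegree (t i)) \<noteq> 0"
    using sum_nth[OF order_refl] i(2) by (metis nth_subdegree_nonzero)
  have "fps_nth (sum t A) l = 0" if "l < subdegree (t i)" for l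
    using sum_nth[of l] nth_less_subdegree_zero[OF that] that by simp
  with nz have "subdegree (sum t A) = subdegree (t i)" by (rule subdegreeI)
  moreover have "sum t A \<noteq> 0" using nz by (metis fps_zero_nth)
  ultimately show ?thesis using that[OF i] min by blast
qed

text \<open>With leading coefficients \<open>1\<close>, top coefficients can be stripped without
  division. Bounding coefficients instead of the degree also covers \<open>m = 0\<close>, where
  \<open>q = 0\<close>.\<close>

lemma monic_family_expansion:
  fixes P :: "nat \<Rightarrow> 'b::comm_ring_1 poly"
  assumes P: "\<And>r. r < m \<Longrightarrow> degree (P r) = r \<and> lead_coeff (P r) = 1"
    and q: "\<And>i. i \<ge> m \<Longrightarrow> coeff q i = 0"
  obtains a where "q = (\<Sum>r<m. smult (a r) (P r))"
proof -
  have "\<exists>a. q = (\<Sum>r<m. smult (a r) (P r))"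
    using assms
  proof (induction m arbitrary: q)
    case 0
    thus ?case by (auto simp: poly_eq_iff)
  next
    case (Suc m)
    let ?b = "coeff q m"
    have low: "coeff (q - smult ?b (P m)) i = 0" if "i \<ge> m" for i
    proof (cases "i = m")
      case True
      have "coeff (P m) m = 1" using Suc.prems(1)[of m] by auto
      thus ?thesis using True by simp
    next
      case False
      hence "coeff (P m) i = 0" "coeff q i = 0"
        using Suc.prems that by (auto intro!: coeff_eq_0)
      thus ?thesis by simp
    qed
    have "degree (P r) = r \<and> lead_coeff (P r) = 1" if "r < m" for r
      using Suc.prems(1) that less_SucI by blast
    then obtain a where "q - smult ?b (P m) = (\<Sum>r<m. smult (a r) (P r))"
      using Suc.IH[OF _ low] by blast
    hence "q = (\<Sum>r<m. smult (a r) (P r)) + smult ?b (P m)" by (simp add: algebra_simps)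
    hence "q = (\<Sum>r<Suc m. smult ((a(m := ?b)) r) (P r))" by simp
    thus ?case by blast
  qed
  thus ?thesis using that by blast
qed

subsection \<open>Monomials and Weierstrass polynomials\<close>

lemma gen_monomials_one: "1 \<in> gen_monomials g f"
  unfolding gen_monomials_def by (rule range_eqI[of _ _ "\<lambda>_. 0"]) simp

lemma gen_monomials_mult:
  assumes "a \<in> gen_monomials g f" "b \<in> gen_monomials g f"
  shows "a * b \<in> gen_monomials g f"
proof -
  from assms obtain c c' where "a = (\<Prod>i\<le>g. fps_of_poly (f i) ^ c i)" "b = (\<Prod>i\<le>g. fps_of_poly (f i) ^ c' i)"
    by (auto simp: gen_monomials_def)
  hence "a * b = (\<Prod>i\<le>g. fps_of_poly (f i) ^ (c i + c' i))"
    by (simp add: power_add prod.distrib)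
  thus ?thesis unfolding gen_monomials_def by (rule range_eqI[where x = "\<lambda>i. c i + c' i"])
qed

lemma gen_monomials_power:
  assumes "a \<in> gen_monomials g f"
  shows "a ^ k \<in> gen_monomials g f"
  by (induction k) (use assms gen_monomials_one gen_monomials_mult in auto)

lemma gen_monomials_prod:
  assumes "\<And>i. i \<in> A \<Longrightarrow> h i \<in> gen_monomials g f"
  shows "prod h A \<in> gen_monomials g f"
  using assms
  by (induction A rule: infinite_finite_induct) (auto intro: gen_monomials_one gen_monomials_mult)

lemma gen_monomials_base:
  assumes "i \<le> g"
  shows "fps_of_poly (f i) \<in> gen_monomials g f"
proof -
  have "(\<Prod>k\<le>g. fps_of_poly (f k) ^ (if k = i then 1 else 0))
      = (\<Prod>k\<le>g. if k = i then fps_of_poly (f i) else 1)"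
    by (rule prod.cong) auto
  also have "\<dots> = fps_of_poly (f i)" using assms by simp
  finally show ?thesis
    unfolding gen_monomials_def by (intro range_eqI[of _ _ "\<lambda>k. if k = i then 1 else 0"]) (rule sym)
qed

text \<open>
  Compare coefficients of \<open>x\<close>-degree \<open>degree F + i\<close>, where \<open>i\<close> is an index at which the \<open>y\<close>-order
  of the coefficients of \<open>H\<close> attains its minimum.
\<close>
lemma weierstrass_degree_le:
  fixes F Q :: "'a::field fps poly"
  assumes F: "monic_weierstrass F" and Q: "Q \<noteq> 0" "fps_of_poly Q = fps_of_poly F * H"
  shows "degree F \<le> degree Q"
proof -
  have "H \<noteq> 0"
  proof
    assume "H = 0"
    hence "fps_of_poly Q = fps_of_poly 0" using Q(2) by simp
    thus False using Q(1) by (simp only: fps_of_poly_eq_iff)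
  qed
  hence "\<exists>s i. fps_nth (fps_nth H i) s \<noteq> 0" by (metis fps_ext fps_zero_nth)
  then obtain s where s: "\<exists>i. fps_nth (fps_nth H i) s \<noteq> 0"
      and min: "\<And>t i. t < s \<Longrightarrow> fps_nth (fps_nth H i) t = 0"
    using exists_least_iff[of "\<lambda>s. \<exists>i. fps_nth (fps_nth H i) s \<noteq> 0"] by blast
  then obtain i where i: "fps_nth (fps_nth H i) s \<noteq> 0" by blast
  let ?k = "degree F + i"
  have lead: "coeff F (degree F) = 1" and low: "\<And>j. j < degree F \<Longrightarrow> fps_nth (coeff F j) 0 = 0"
    using F by (auto simp: monic_weierstrass_def)
  \<comment> \<open>Here \<open>coeff F j\<close> has no constant term in \<open>y\<close>, and the
    coefficients of \<open>H\<close> have \<open>y\<close>-order at least \<open>s\<close>, so the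
    product has order above \<open>s\<close>.\<close>
  have zero: "fps_nth (coeff F j * fps_nth H l) s = 0" if "j \<noteq> degree F" for j l
  proof -
    have "fps_nth (coeff F j) 0 = 0"
      using low[of j] that coeff_eq_0[of F j] by (cases "j < degree F") auto
    hence "fps_nth (coeff F j) t * fps_nth (fps_nth H l) (s - t) = 0" if "t \<le> s" for t
      using min[of "s - t" l] that by (cases "t = 0") auto
    thus ?thesis unfolding fps_mult_nth by (intro sum.neutral) simp
  qed
  have "fps_nth (coeff Q ?k) s = (\<Sum>j\<in>{0..?k}. fps_nth (coeff F j * fps_nth H (?k - j)) s)"
    using arg_cong[OF Q(2), of "\<lambda>q. fps_nth (fps_nth q ?k) s"]
    by (simp add: fps_mult_nth[of "fps_of_poly F"] fps_sum_nth)
  also have "\<dots> = (\<Sum>j\<in>{degree F}. fps_nth (coeff F j * fps_nth H (?k - j)) s)"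
    by (rule sum.mono_neutral_right) (use zero in auto)
  also have "\<dots> = fps_nth (fps_nth H i) s" using lead by simp
  finally have "coeff Q ?k \<noteq> 0" using i by (metis fps_zero_nth)
  hence "?k \<le> degree Q" by (rule le_degree)
  thus ?thesis by simp
qed

subsection \<open>The substitution homomorphism\<close>

locale branch_param =
  fixes X Y :: "'a::field fps"
  assumes X_0: "fps_nth X 0 = 0" and Y_0: "fps_nth Y 0 = 0"
begin

abbreviation "\<phi> \<equiv> subst_xy X Y"

text \<open>\<open>X ^ i\<close> has order at least \<open>i\<close>, so a later truncation changes
  nothing; one bound can then serve several coefficients.\<close>

lemma subst_xy_nth:
  assumes "l \<le> k"
  shows "fps_nth (\<phi> h) l = fps_nth (\<Sum>i\<le>k. (fps_nth h i oo Y) * X ^ i) l"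
proof -
  have "fps_nth ((fps_nth h i oo Y) * X ^ i) l = 0" if "i > l" for i
    using startsby_zero_power_prefix[OF X_0] that by (simp add: fps_mult_nth)
  hence "(\<Sum>i\<le>k. fps_nth ((fps_nth h i oo Y) * X ^ i) l) = (\<Sum>i\<le>l. fps_nth ((fps_nth h i oo Y) * X ^ i) l)"
    by (intro sum.mono_neutral_right) (use assms in auto)
  thus ?thesis by (simp add: subst_xy_def fps_sum_nth)
qed

lemma subst_xy_poly: "\<phi> (fps_of_poly p) = (\<Sum>i\<le>degree p. (coeff p i oo Y) * X ^ i)"
proof (rule fps_ext)
  fix l
  have "fps_nth (\<phi> (fps_of_poly p)) l
      = fps_nth (\<Sum>i\<le>max l (degree p). (coeff p i oo Y) * X ^ i) l"
    by (subst subst_xy_nth[of l "max l (degree p)"]) simp_all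
  also have "(\<Sum>i\<le>max l (degree p). (coeff p i oo Y) * X ^ i) = (\<Sum>i\<le>degree p. (coeff p i oo Y) * X ^ i)"
    by (rule sum.mono_neutral_right) (auto simp: coeff_eq_0)
  finally show "fps_nth (\<phi> (fps_of_poly p)) l = fps_nth (\<Sum>i\<le>degree p. (coeff p i oo Y) * X ^ i) l" .
qed

lemma subst_xy_const: "\<phi> (fps_const a) = a oo Y"
  using subst_xy_poly[of "[:a:]"] by (simp add: fps_of_poly_const)

lemma subst_xy_0 [simp]: "\<phi> 0 = 0"
  using subst_xy_const[of 0] by simp

lemma subst_xy_1 [simp]: "\<phi> 1 = 1"
  using subst_xy_const[of 1] by simp

lemma subst_xy_fps_X [simp]: "\<phi> fps_X = X"
  using subst_xy_poly[of "[:0, 1:]"] by simp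

lemma subst_xy_add: "\<phi> (p + q) = \<phi> p + \<phi> q"
  by (rule fps_ext)
     (simp add: subst_xy_def fps_sum_nth fps_compose_add_distrib distrib_right sum.distrib)

text \<open>Index pairs with \<open>i + j > l\<close> do not reach coefficient \<open>l\<close>, so
  the square of pairs shrinks to a triangle, resummed along \<open>k = i + j\<close>.\<close>

lemma subst_xy_mult: "\<phi> (p * q) = \<phi> p * \<phi> q"
proof (rule fps_ext)
  fix l
  define S where "S = (\<lambda>h. \<Sum>i\<le>l. (fps_nth h i oo Y) * X ^ i)"
  let ?t = "\<lambda>i j. (fps_nth p i oo Y) * (fps_nth q j oo Y) * X ^ (i + j)"
  have "fps_nth (\<phi> p * \<phi> q) l = fps_nth (S p * S q) l"
    unfolding fps_mult_nth by (rule sum.cong) (simp_all add: S_def subst_xy_nth[of _ l])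
  also have "S p * S q = (\<Sum>(i, j)\<in>{..l} \<times> {..l}. ?t i j)"
    by (simp add: S_def sum_product sum.cartesian_product power_add mult_ac)
  also have "fps_nth \<dots> l = (\<Sum>(i, j)\<in>{..l} \<times> {..l}. fps_nth (?t i j) l)"
    by (simp add: fps_sum_nth split_def)
  also have "\<dots> = (\<Sum>(i, j)\<in>{(i, j). i + j \<le> l}. fps_nth (?t i j) l)"
  proof (rule sum.mono_neutral_right)
    have "fps_nth (?t i j) l = 0" if "i + j > l" for i j
      using startsby_zero_power_prefix[OF X_0] that by (subst fps_mult_nth) simp
    thus "\<forall>x\<in>{..l} \<times> {..l} - {(i, j). i + j \<le> l}. (case x of (i, j) \<Rightarrow> fps_nth (?t i j) l) = 0"
      by (auto simp: not_le[symmetric])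
  qed auto
  also have "\<dots> = (\<Sum>k\<le>l. \<Sum>i\<le>k. fps_nth (?t i (k - i)) l)"
    by (rule sum.triangle_reindex_eq)
  also have "\<dots> = (\<Sum>k\<le>l. fps_nth ((fps_nth (p * q) k oo Y) * X ^ k) l)"
  proof (rule sum.cong[OF refl])
    fix k
    have "(fps_nth (p * q) k oo Y) * X ^ k = (\<Sum>i\<le>k. ?t i (k - i))"
      by (simp add: fps_mult_nth fps_compose_sum_distrib fps_compose_mult_distrib[OF Y_0]
          sum_distrib_right atLeast0AtMost)
    thus "(\<Sum>i\<le>k. fps_nth (?t i (k - i)) l) = fps_nth ((fps_nth (p * q) k oo Y) * X ^ k) l"
      by (simp add: fps_sum_nth)
  qed
  also have "\<dots> = fps_nth (\<phi> (p * q)) l" by (simp add: subst_xy_def fps_sum_nth)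
  finally show "fps_nth (\<phi> (p * q)) l = fps_nth (\<phi> p * \<phi> q) l" ..
qed

lemma subst_xy_diff: "\<phi> (p - q) = \<phi> p - \<phi> q"
  using subst_xy_add[of "p - q" q] by (simp add: algebra_simps)

lemma subst_xy_power: "\<phi> (p ^ k) = \<phi> p ^ k"
  by (induction k) (simp_all add: subst_xy_mult)

lemma subst_xy_sum: "\<phi> (sum h A) = (\<Sum>i\<in>A. \<phi> (h i))"
  by (induction A rule: infinite_finite_induct) (simp_all add: subst_xy_add)

lemma subst_xy_prod: "\<phi> (prod h A) = (\<Prod>i\<in>A. \<phi> (h i))"
  by (induction A rule: infinite_finite_induct) (simp_all add: subst_xy_mult)

sublocale fps_subspace "branch_ring X Y"
proof
  show "0 \<in> branch_ring X Y" unfolding branch_ring_def by (rule range_eqI[of _ _ 0]) simp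
  show "p + q \<in> branch_ring X Y" if "p \<in> branch_ring X Y" "q \<in> branch_ring X Y" for p q
    using that unfolding branch_ring_def by (auto simp flip: subst_xy_add)
  show "fps_const c * p \<in> branch_ring X Y" if p: "p \<in> branch_ring X Y" for c p
  proof -
    obtain h where "p = \<phi> h" using p by (auto simp: branch_ring_def)
    hence "fps_const c * p = \<phi> (fps_const (fps_const c) * h)"
      by (simp add: subst_xy_mult subst_xy_const)
    thus ?thesis by (simp add: branch_ring_def)
  qed
qed

end

subsection \<open>Expansions in semiroots\<close>

locale plane_branch = branch_param X Y + char_seq g \<beta>
  for X Y :: "'a::field fps" and g :: nat and \<beta> :: "nat \<Rightarrow> nat" +
  fixes f :: "nat \<Rightarrow> 'a fps poly" and F :: "'a fps poly"
  assumes beta_0: "\<beta> 0 = subdegree Y"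
    and beta_0_less: "\<beta> 0 < \<beta> 1"
    and f_0: "f 0 = [:fps_X:]"
    and f_1: "f 1 = [:0, 1:]"
    and lead_coeff_f: "\<And>i. i \<in> {1..g} \<Longrightarrow> lead_coeff (f i) = 1"
    and degree_f: "\<And>i. i \<in> {1..g} \<Longrightarrow> degree (f i) = d i"
    and nu_f: "\<And>i. i \<in> {1..g} \<Longrightarrow> nu X Y (fps_of_poly (f i)) = \<beta> i"
    and weierstrass: "monic_weierstrass F"
    and kernel: "{h. subst_xy X Y h = 0} = ideal_gen {fps_of_poly F}"
    and semigroup: "value_semigroup (branch_ring X Y) = range (\<lambda>c :: nat \<Rightarrow> nat. \<Sum>i\<le>g. c i * \<beta> i)"
begin

definition \<psi> :: "'a fps poly \<Rightarrow> 'a fps" where "\<psi> p = subst_xy X Y (fps_of_poly p)"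

definition P :: "nat \<Rightarrow> 'a fps poly" where "P r = (\<Prod>i\<in>{1..g}. f i ^ digit r i)"

lemma psi_0 [simp]: "\<psi> 0 = 0"
  and psi_diff: "\<psi> (p - q) = \<psi> p - \<psi> q"
  and psi_mult: "\<psi> (p * q) = \<psi> p * \<psi> q"
  and psi_power: "\<psi> (p ^ k) = \<psi> p ^ k"
  and psi_sum: "\<psi> (sum h A) = (\<Sum>i\<in>A. \<psi> (h i))"
  and psi_prod: "\<psi> (prod h A) = (\<Prod>i\<in>A. \<psi> (h i))"
  and psi_smult: "\<psi> (smult a p) = (a oo Y) * \<psi> p"
  by (simp_all add: \<psi>_def fps_of_poly_diff fps_of_poly_mult fps_of_poly_power
      fps_of_poly_sum fps_of_poly_prod fps_of_poly_smult subst_xy_diff subst_xy_mult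
      subst_xy_power subst_xy_sum subst_xy_prod subst_xy_const)

lemma subdegree_Y_pos: "subdegree Y > 0"
  using beta_0_pos beta_0 by simp

lemma Y_nonzero: "Y \<noteq> 0"
  using subdegree_Y_pos by auto

lemma compose_Y_eq_0_iff: "a oo Y = 0 \<longleftrightarrow> a = 0"
  using Y_nonzero Y_0 by (simp add: fps_compose_eq_0_iff)

text \<open>Zero would be divisible by \<open>e (i - 1)\<close>. Positivity is what excludes a
  vanishing image of \<open>f i\<close>, since \<open>nu\<close> is \<open>0\<close> on the
  kernel.\<close>

lemma beta_pos: "i \<le> g \<Longrightarrow> \<beta> i > 0"
  using beta_not_dvd[of i] beta_0_pos by (cases "i = 0") (auto intro: gr0I)

lemma subdegree_psi_f:
  assumes "i \<le> g"
  shows "\<psi> (f i) \<noteq> 0 \<and> subdegree (\<psi> (f i)) = \<beta> i"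
proof (cases "i = 0")
  case True
  have "\<psi> (f 0) = Y"
    by (simp add: f_0 \<psi>_def fps_of_poly_const subst_xy_const Y_0)
  thus ?thesis using True Y_nonzero beta_0 by simp
next
  case False
  hence "subdegree (\<psi> (f i)) = \<beta> i" using nu_f[of i] assms by (simp add: nu_def \<psi>_def)
  thus ?thesis using beta_pos[OF assms] by auto
qed

section \<open>Digit products of semiroots and their combinations\<close>

lemma P_add:
  assumes "j \<in> {1..g}" "r < d j" "k < n j"
  shows "P (r + k * d j) = P r * f j ^ k"
proof -
  have "P (r + k * d j) = (\<Prod>i\<in>{1..g}. f i ^ digit r i * (if i = j then f j ^ k else 1))"
    unfolding P_def by (rule prod.cong) (use assms digit_add digit_eq_0 in auto)
  also have "\<dots> = P r * f j ^ k"
    using assms by (simp add: prod.distrib P_def)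
  finally show ?thesis .
qed

lemma degree_P:
  assumes "r < \<beta> 0"
  shows "degree (P r) = r \<and> lead_coeff (P r) = 1"
proof -
  have "r < d (Suc g)" using assms d_last by simp
  from this order_refl show ?thesis
  proof (induction r rule: digit_induct)
    case zero
    thus ?case by (simp add: P_def digit_def)
  next
    case (step i r k)
    have "P r \<noteq> 0" "f i \<noteq> 0" using step lead_coeff_f[of i] by auto
    hence "degree (P r * f i ^ k) = r + k * d i"
      using step degree_f[of i] by (simp add: degree_mult_eq degree_power_eq)
    moreover have "lead_coeff (P r) = 1" "lead_coeff (f i) = 1"
      using step lead_coeff_f[of i] by blast+
    hence "lead_coeff (P r * f i ^ k) = 1"
      by (simp only: lead_coeff_mult lead_coeff_power power_one mult_1_right)
    ultimately show ?case using step by (simp only: P_add)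
  qed
qed

lemma subdegree_psi_P: "\<psi> (P r) \<noteq> 0 \<and> subdegree (\<psi> (P r)) = w r"
proof -
  define t where "t = (\<lambda>i. \<psi> (f i) ^ digit r i)"
  have eq: "\<psi> (P r) = (\<Prod>i\<in>{1..g}. t i)"
    by (simp add: P_def psi_prod psi_power t_def)
  have t: "t i \<noteq> 0" "subdegree (t i) = digit r i * \<beta> i" if "i \<in> {1..g}" for i
    using subdegree_psi_f[of i] that by (simp_all add: t_def)
  have "subdegree (\<Prod>i\<in>{1..g}. t i) = (\<Sum>i\<in>{1..g}. subdegree (t i))"
    by (rule subdegree_prod) (rule t)
  also have "\<dots> = w r" unfolding w_def by (intro sum.cong refl t)
  finally show ?thesis using t(1) by (simp add: eq)
qed

lemma subdegree_term:
  assumes "a \<noteq> 0"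
  shows "\<psi> (smult a (P r)) \<noteq> 0 \<and> subdegree (\<psi> (smult a (P r))) = subdegree a * \<beta> 0 + w r"
  using assms subdegree_psi_P[of r] compose_Y_eq_0_iff[of a] Y_0 by (simp add: psi_smult beta_0)

lemma term_eq_0_iff: "\<psi> (smult a (P r)) = 0 \<longleftrightarrow> a = 0"
  using subdegree_term[of a r] by auto

text \<open>Terms of equal value would have \<open>w r\<close> and \<open>w q\<close> congruent
  modulo \<open>\<beta> 0\<close>, so \<open>subdegree_sum_distinct\<close> applies.\<close>

lemma subdegree_combination:
  assumes "m \<le> \<beta> 0" "s < m" "a s \<noteq> 0"
  obtains r where "r < m" "a r \<noteq> 0" "\<psi> (\<Sum>r<m. smult (a r) (P r)) \<noteq> 0"
    "subdegree (\<psi> (\<Sum>r<m. smult (a r) (P r))) = subdegree (a r) * \<beta> 0 + w r"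
    "\<And>q. q < m \<Longrightarrow> a q \<noteq> 0 \<Longrightarrow> subdegree (a r) * \<beta> 0 + w r \<le> subdegree (a q) * \<beta> 0 + w q"
proof -
  let ?t = "\<lambda>r. \<psi> (smult (a r) (P r))"
  have distinct: "r = q" if "r \<in> {..<m}" "q \<in> {..<m}" "?t r \<noteq> 0" "?t q \<noteq> 0" "subdegree (?t r) = subdegree (?t q)" for r q
  proof -
    have "a r \<noteq> 0" "a q \<noteq> 0" using that by (auto simp: term_eq_0_iff)
    hence "int (subdegree (a r) * \<beta> 0 + w r) = int (subdegree (a q) * \<beta> 0 + w q)"
      using that(5) subdegree_term by metis
    hence "int (w r) - int (w q) = int (\<beta> 0) * (int (subdegree (a q)) - int (subdegree (a r)))"
      by (simp add: algebra_simps)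
    thus ?thesis using w_inj_mod[of r g q] that(1,2) assms(1) d_last by simp
  qed
  have s: "s \<in> {..<m}" "?t s \<noteq> 0" using assms by (auto simp: term_eq_0_iff)
  show ?thesis
  proof (rule subdegree_sum_distinct[where t = ?t and A = "{..<m}" and k = s,
        OF finite_lessThan distinct s])
    fix r assume r: "r \<in> {..<m}" "?t r \<noteq> 0" "sum ?t {..<m} \<noteq> 0"
      "subdegree (sum ?t {..<m}) = subdegree (?t r)"
      and min: "\<And>q. q \<in> {..<m} \<Longrightarrow> ?t q \<noteq> 0 \<Longrightarrow> subdegree (?t r) \<le> subdegree (?t q)"
    have ar: "a r \<noteq> 0" using r by (auto simp: term_eq_0_iff)
    show thesis
    proof (rule that)
      show "r < m" "a r \<noteq> 0" using r ar by simp_all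
      show "\<psi> (\<Sum>r<m. smult (a r) (P r)) \<noteq> 0" using r(3) by (simp add: psi_sum)
      show "subdegree (\<psi> (\<Sum>r<m. smult (a r) (P r))) = subdegree (a r) * \<beta> 0 + w r"
        using r(4) subdegree_term[OF ar] by (simp add: psi_sum)
      show "subdegree (a r) * \<beta> 0 + w r \<le> subdegree (a q) * \<beta> 0 + w q" if "q < m" "a q \<noteq> 0" for q
        using min[of q] that subdegree_term[of "a q" q] subdegree_term[OF ar] by simp
    qed
  qed
qed

lemma expansion:
  assumes "m \<le> \<beta> 0" "\<And>i. i \<ge> m \<Longrightarrow> coeff q i = 0"
  obtains a where "q = (\<Sum>r<m. smult (a r) (P r))"
  using monic_family_expansion[of m P q] degree_P assms by (metis order_less_le_trans)

text \<open>A nonzero combination of the \<open>P r\<close> has a nonzero image; this bounds the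
  degree of the equation from below.\<close>

lemma low_degree_not_kernel:
  assumes "\<And>i. i \<ge> \<beta> 0 \<Longrightarrow> coeff q i = 0" "\<psi> q = 0"
  shows "q = 0"
proof -
  obtain a where a: "q = (\<Sum>r<\<beta> 0. smult (a r) (P r))" using expansion[of "\<beta> 0" q] assms(1) by blast
  have "a r = 0" if "r < \<beta> 0" for r
    using subdegree_combination[of "\<beta> 0" r a] that assms(2) a by (metis order_refl)
  thus ?thesis using a by simp
qed

text \<open>Both \<open>f j ^ n j\<close> and the remaining sum have values divisible by
  \<open>e j\<close>, whereas \<open>\<psi> Q\<close> is zero or has no such value. Hence their
  leading terms cancel, which forces equal values.\<close>

lemma semiroot_relation:
  assumes j: "j \<in> {1..g}" and Q: "lead_coeff Q = 1" "degree Q = d (Suc j)"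
    and val: "\<psi> Q = 0 \<or> \<not> e j dvd subdegree (\<psi> Q)"
  obtains a where "Q = f j ^ n j + (\<Sum>r<d (Suc j). smult (a r) (P r))"
    and "\<And>r. r < d (Suc j) \<Longrightarrow> a r \<noteq> 0 \<Longrightarrow> n j * \<beta> j \<le> subdegree (a r) * \<beta> 0 + w r"
    and "\<exists>k r. r < d j \<and> n j * \<beta> j = k * \<beta> 0 + w r"
    and "\<psi> Q \<noteq> 0 \<Longrightarrow> n j * \<beta> j \<le> subdegree (\<psi> Q)"
proof -
  let ?m = "d (Suc j)"
  have m: "?m \<le> \<beta> 0" using d_mono[of "Suc j" "Suc g"] j d_last by simp
  have fj: "\<psi> (f j) ^ n j \<noteq> 0" "subdegree (\<psi> (f j) ^ n j) = n j * \<beta> j"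
    using subdegree_psi_f[of j] j by simp_all
  have f_nz: "f j \<noteq> 0" using lead_coeff_f[OF j] by auto
  have deg_fn: "degree (f j ^ n j) = ?m"
    using f_nz degree_f[OF j] d_Suc[of j] j by (simp add: degree_power_eq mult.commute)
  have lead_fn: "lead_coeff (f j ^ n j) = 1" using lead_coeff_f[OF j] by (simp add: lead_coeff_power)
  have "coeff (Q - f j ^ n j) i = 0" if "i \<ge> ?m" for i
  proof (cases "i = ?m")
    case True
    thus ?thesis using Q lead_fn deg_fn by simp
  next
    case False
    thus ?thesis using that Q(2) deg_fn by (simp add: coeff_eq_0)
  qed
  then obtain a where a: "Q - f j ^ n j = (\<Sum>r<?m. smult (a r) (P r))"
    using expansion[OF m] by blast
  let ?S = "\<psi> (\<Sum>r<?m. smult (a r) (P r))"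
  have S: "\<psi> Q = \<psi> (f j) ^ n j + ?S"
    using arg_cong[OF a, of \<psi>] by (simp add: psi_diff psi_power algebra_simps)
  have e_dvd: "e j dvd n j * \<beta> j" using e_dvd_beta[of j j] by simp
  have "\<exists>s<?m. a s \<noteq> 0"
  proof (rule ccontr)
    assume "\<not> ?thesis"
    hence "?S = 0" by simp
    hence "\<psi> Q = \<psi> (f j) ^ n j" using S by simp
    thus False using val fj e_dvd by metis
  qed
  then obtain s where s: "s < ?m" "a s \<noteq> 0" by blast
  obtain r where r: "r < ?m" "a r \<noteq> 0" "?S \<noteq> 0" "subdegree ?S = subdegree (a r) * \<beta> 0 + w r"
      and min: "\<And>q. q < ?m \<Longrightarrow> a q \<noteq> 0 \<Longrightarrow> subdegree (a r) * \<beta> 0 + w r \<le> subdegree (a q) * \<beta> 0 + w q"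
    using subdegree_combination[of ?m s a, OF m s] by blast
  have dvd_S: "e j dvd subdegree ?S"
    using e_dvd_beta[of 0 j] e_dvd_w[of r j] r j by simp
  have val_less: "\<psi> Q \<noteq> 0 \<and> subdegree (\<psi> Q) = subdegree ?S" if "subdegree ?S < n j * \<beta> j"
  proof
    show sub: "subdegree (\<psi> Q) = subdegree ?S"
      unfolding S using that r(3) fj(2) by (intro subdegree_add_eq2) auto
    show "\<psi> Q \<noteq> 0"
      using r(3) that fj S by (metis add.inverse_inverse add_eq_0_iff less_irrefl subdegree_uminus)
  qed
  have val_greater: "\<psi> Q \<noteq> 0 \<and> subdegree (\<psi> Q) = n j * \<beta> j" if "n j * \<beta> j < subdegree ?S"
  proof
    show sub: "subdegree (\<psi> Q) = n j * \<beta> j"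
      unfolding S using that fj by (subst subdegree_add_eq1) auto
    show "\<psi> Q \<noteq> 0"
      using r(3) that fj S by (metis add.inverse_inverse add_eq_0_iff less_irrefl subdegree_uminus)
  qed
  have sub_S: "subdegree ?S = n j * \<beta> j"
  proof (cases "subdegree ?S" "n j * \<beta> j" rule: linorder_cases)
    case less
    thus ?thesis using val dvd_S val_less by simp
  next
    case greater
    thus ?thesis using val e_dvd val_greater by simp
  qed
  \<comment> \<open>The minimal term contains no factor \<open>f j\<close>: its exponent
    \<open>k < n j\<close> is divisible by \<open>n j\<close>, as all other contributions are
    multiples of \<open>e (j - 1)\<close>.\<close>
  have "\<exists>k r. r < d j \<and> n j * \<beta> j = k * \<beta> 0 + w r"
  proof -
    define r0 k where "r0 = r mod d j" "k = r div d j"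
    have pos: "d j > 0" using d_pos[of j] j by simp
    have lt: "r0 < d j" "k < n j"
      using pos r(1) d_Suc[of j] j by (simp_all add: r0_k_def less_mult_imp_div_less mult.commute)
    have r_eq: "r = r0 + k * d j" by (simp only: r0_k_def mod_div_mult_eq)
    have w: "w r = w r0 + k * \<beta> j" using w_add[OF j lt] r_eq by simp
    have "e (j - 1) dvd n j * \<beta> j"
      using e_mult[OF j] e_dvd_beta[of j j] by (simp add: mult_dvd_mono)
    moreover have "e (j - 1) dvd subdegree (a r) * \<beta> 0 + w r0"
    proof (intro dvd_add dvd_mult)
      show "e (j - 1) dvd \<beta> 0" by (rule e_dvd_beta) simp
      show "e (j - 1) dvd w r0" by (rule e_dvd_w) (use lt j in auto)
    qed
    moreover have "n j * \<beta> j = (subdegree (a r) * \<beta> 0 + w r0) + k * \<beta> j"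
      using r(4) sub_S w by simp
    ultimately have "e (j - 1) dvd k * \<beta> j" by (metis dvd_add_right_iff)
    hence "int (e (j - 1)) dvd int k * int (\<beta> j)" by (metis int_dvd_int_iff of_nat_mult)
    hence "n j dvd k" using n_dvd[OF j, of "int k"] by simp
    hence "k = 0" using lt by auto
    thus ?thesis using lt(1) r(4) sub_S w by auto
  qed
  moreover have "n j * \<beta> j \<le> subdegree (\<psi> Q)" if "\<psi> Q \<noteq> 0"
  proof -
    have "min (subdegree (\<psi> (f j) ^ n j)) (subdegree ?S) \<le> subdegree (\<psi> (f j) ^ n j + ?S)"
      using that S by (intro subdegree_add_ge') auto
    thus ?thesis by (simp only: S sub_S fj(2) min.idem)
  qed
  ultimately show ?thesis
    using that[of a] a min sub_S r(4) by (simp add: algebra_simps)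
qed

end

subsection \<open>The conductor\<close>

context plane_branch
begin

text \<open>The closed form of \<open>2 * delta\<close>, confirmed in \<open>conductor\<close>; by
  \<open>beta_0_le_sigma\<close> the subtraction does not truncate.\<close>

definition c :: nat where "c = \<sigma> + 1 - \<beta> 0"

lemma beta_0_le_sigma: "\<beta> 0 \<le> \<sigma>"
proof -
  have "\<beta> 0 \<le> (n 1 - 1) * \<beta> 1"
    using beta_0_less char_n_gt_1[of 1] g_pos
    by (metis atLeastAtMost_iff le_refl less_imp_le mult_le_mono nat_mult_1 less_diff_conv
        Suc_leI add_0 One_nat_def)
  also have "\<dots> \<le> \<sigma>"
    unfolding \<sigma>_def by (rule member_le_sum) (use g_pos in auto)
  finally show ?thesis .
qed

section \<open>Generalized monomials of prescribed value\<close>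

lemma P_monomial: "fps_of_poly (P r) \<in> gen_monomials g f"
  unfolding P_def fps_of_poly_prod fps_of_poly_power
  by (intro gen_monomials_prod gen_monomials_power gen_monomials_base) simp

lemma y_power_monomial: "fps_const (fps_X ^ l) \<in> gen_monomials g f"
proof -
  have "fps_of_poly (f 0) ^ l \<in> gen_monomials g f"
    by (intro gen_monomials_power gen_monomials_base) simp
  thus ?thesis by (simp add: f_0 fps_of_poly_const fps_const_power)
qed

lemma nu_mult:
  assumes "subst_xy X Y a \<noteq> 0" "subst_xy X Y b \<noteq> 0"
  shows "nu X Y (a * b) = nu X Y a + nu X Y b"
  using assms by (simp add: nu_def subst_xy_mult)

lemma monomial_nonzero:
  assumes "m \<in> gen_monomials g f"
  shows "subst_xy X Y m \<noteq> 0"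
  using assms subdegree_psi_f
  by (auto simp: gen_monomials_def subst_xy_prod subst_xy_power \<psi>_def)

lemma nu_P: "nu X Y (fps_of_poly (P r)) = w r"
  using subdegree_psi_P by (simp add: nu_def \<psi>_def)

lemma nu_y_power: "nu X Y (fps_const (fps_X ^ l)) = l * \<beta> 0"
  using Y_0 by (simp add: nu_def subst_xy_const beta_0)

lemma large_value:
  assumes "c \<le> k"
  obtains l r where "r < \<beta> 0" "k = l * \<beta> 0 + w r"
proof -
  have "k \<in> Apery_hull" by (rule Apery_hull_large) (use assms in \<open>simp add: c_def\<close>)
  thus ?thesis using that by (auto simp: Apery_hull_def)
qed

lemma monomial_of_large_value:
  assumes "c \<le> k"
  shows "\<exists>m\<in>gen_monomials g f. nu X Y m = k"
proof -
  obtain l r where k: "k = l * \<beta> 0 + w r" using large_value[OF assms] by blast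
  show ?thesis
  proof
    show "fps_const (fps_X ^ l) * fps_of_poly (P r) \<in> gen_monomials g f"
      by (intro gen_monomials_mult y_power_monomial P_monomial)
    show "nu X Y (fps_const (fps_X ^ l) * fps_of_poly (P r)) = k"
      using nu_mult[OF monomial_nonzero[OF y_power_monomial] monomial_nonzero[OF P_monomial]]
      by (simp add: k nu_P nu_y_power)
  qed
qed

text \<open>Every order from \<open>c\<close> on is the value of some \<open>y ^ l * P r\<close>, so
  \<open>fps_expansion\<close> applies. This serves both the degree of \<open>F\<close> and the
  conductor.\<close>

lemma large_expansion:
  assumes "\<And>i. i < c \<Longrightarrow> fps_nth h i = 0"
  obtains q where "\<And>i. i \<ge> \<beta> 0 \<Longrightarrow> coeff q i = 0" "\<psi> q = h"
proof -
  have "\<forall>k. \<exists>l r. r < \<beta> 0 \<and> c + k = l * \<beta> 0 + w r" using large_value le_add1 by metis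
  then obtain l r where lr: "\<And>k. r k < \<beta> 0" "\<And>k. c + k = l k * \<beta> 0 + w (r k)" by metis
  define p where "p = (\<lambda>k. smult (fps_X ^ l k) (P (r k)))"
  have p: "\<psi> (p k) \<noteq> 0 \<and> subdegree (\<psi> (p k)) = c + k" for k
    using subdegree_term[of "fps_X ^ l k" "r k"] lr(2)[of k] by (simp add: p_def)
  obtain a where a: "h = (\<Sum>k<subdegree Y. (a k oo Y) * \<psi> (p k))"
    using fps_expansion[of Y "\<lambda>k. \<psi> (p k)" c h] subdegree_Y_pos p assms by metis
  show ?thesis
  proof (rule that)
    show "\<psi> (\<Sum>k<subdegree Y. smult (a k) (p k)) = h"
      by (simp add: psi_sum psi_smult a)
    show "coeff (\<Sum>k<subdegree Y. smult (a k) (p k)) i = 0" if "i \<ge> \<beta> 0" for i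
    proof -
      have "coeff (P (r k)) i = 0" for k
        using degree_P[OF lr(1)] lr(1)[of k] that by (intro coeff_eq_0) simp
      thus ?thesis by (simp add: coeff_sum p_def)
    qed
  qed
qed

section \<open>The degree of the equation and the semiroot relations\<close>

lemma psi_F: "\<psi> F = 0"
proof -
  have "fps_of_poly F \<in> {h. subst_xy X Y h = 0}"
    unfolding kernel by (rule ideal_gen_base) simp
  thus ?thesis by (simp add: \<psi>_def)
qed

lemma lead_coeff_F: "lead_coeff F = 1"
  using weierstrass by (simp add: monic_weierstrass_def)

lemma kernel_dvd: "subst_xy X Y h = 0 \<Longrightarrow> fps_of_poly F dvd h"
  using kernel ideal_gen_singleton by blast

text \<open>The factor \<open>y ^ c\<close> lifts the value of \<open>y ^ c * x ^ \<beta> 0\<close>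
  to at least \<open>c\<close>, so subtracting a polynomial of lower degree moves it into the
  kernel. As \<open>F\<close> divides the result only among power series,
  \<open>weierstrass_degree_le\<close> is needed.\<close>

lemma degree_F: "degree F = \<beta> 0"
proof (rule antisym)
  define Q0 where "Q0 = monom (fps_X ^ c :: 'a fps) (\<beta> 0)"
  have Q0: "Q0 = f 0 ^ c * f 1 ^ \<beta> 0"
    by (simp add: Q0_def f_0 f_1[unfolded One_nat_def] monom_altdef poly_const_pow)
  have psi: "\<psi> (f 0) = Y" "\<psi> (f 1) = X"
    by (simp_all add: \<psi>_def f_0 f_1[unfolded One_nat_def] fps_of_poly_const subst_xy_const Y_0)
  have "fps_nth (\<psi> Q0) i = 0" if "i < c" for i
    using startsby_zero_power_prefix[OF Y_0] that by (simp add: Q0 psi_mult psi_power psi fps_mult_nth)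
  then obtain q where q: "\<And>i. i \<ge> \<beta> 0 \<Longrightarrow> coeff q i = 0" "\<psi> q = \<psi> Q0"
    using large_expansion by blast
  define Q where "Q = Q0 - q"
  have "coeff Q (\<beta> 0) = fps_X ^ c" using q(1) by (simp add: Q_def Q0_def)
  hence "Q \<noteq> 0" by auto
  moreover have "subst_xy X Y (fps_of_poly Q) = 0"
    using q(2) psi_diff[of Q0 q] by (simp add: Q_def \<psi>_def)
  then obtain H where "fps_of_poly Q = fps_of_poly F * H" using kernel_dvd by (metis dvdE)
  ultimately have "degree F \<le> degree Q" using weierstrass_degree_le[OF weierstrass] by blast
  also have "degree Q \<le> \<beta> 0"
    by (rule degree_le) (use q(1) in \<open>auto simp: Q_def Q0_def\<close>)
  finally show "degree F \<le> \<beta> 0" .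
  show "\<beta> 0 \<le> degree F"
  proof (rule ccontr)
    assume "\<not> \<beta> 0 \<le> degree F"
    hence "F = 0" by (intro low_degree_not_kernel) (simp_all add: coeff_eq_0 psi_F)
    thus False using lead_coeff_F by simp
  qed
qed

text \<open>The equation itself plays the role of a semiroot of infinite value.\<close>
definition semiroot :: "nat \<Rightarrow> 'a fps poly" where "semiroot i = (if i \<le> g then f i else F)"

text \<open>For \<open>j < g\<close> the value \<open>\<beta> (Suc j)\<close> is not divisible by
  \<open>e j\<close>; for \<open>j = g\<close> the image of \<open>F\<close> vanishes. Either way
  \<open>semiroot_relation\<close> applies.\<close>

lemma semiroot_or_equation_relation:
  assumes j: "j \<in> {1..g}"
  obtains a where "semiroot (Suc j) = f j ^ n j + (\<Sum>r<d (Suc j). smult (a r) (P r))"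
    and "\<And>r. r < d (Suc j) \<Longrightarrow> a r \<noteq> 0 \<Longrightarrow> n j * \<beta> j \<le> subdegree (a r) * \<beta> 0 + w r"
    and "\<exists>k r. r < d j \<and> n j * \<beta> j = k * \<beta> 0 + w r"
    and "j < g \<Longrightarrow> n j * \<beta> j \<le> \<beta> (Suc j)"
proof -
  have *: "lead_coeff (semiroot (Suc j)) = 1" "degree (semiroot (Suc j)) = d (Suc j)"
    "\<psi> (semiroot (Suc j)) = 0 \<or> \<not> e j dvd subdegree (\<psi> (semiroot (Suc j)))"
    and nz: "j < g \<Longrightarrow> \<psi> (semiroot (Suc j)) \<noteq> 0 \<and> subdegree (\<psi> (semiroot (Suc j))) = \<beta> (Suc j)"
    using j lead_coeff_F degree_F d_last psi_F lead_coeff_f[of "Suc j"] degree_f[of "Suc j"]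
      subdegree_psi_f[of "Suc j"] beta_not_dvd[of "Suc j"]
    by (cases "j = g"; auto simp: semiroot_def)+
  show ?thesis
  proof (rule semiroot_relation[OF j *])
    fix a
    assume rel: "semiroot (Suc j) = f j ^ n j + (\<Sum>r<d (Suc j). smult (a r) (P r))"
      and bound: "\<And>r. r < d (Suc j) \<Longrightarrow> a r \<noteq> 0 \<Longrightarrow> n j * \<beta> j \<le> subdegree (a r) * \<beta> 0 + w r"
      and ex: "\<exists>k r. r < d j \<and> n j * \<beta> j = k * \<beta> 0 + w r"
      and le: "\<psi> (semiroot (Suc j)) \<noteq> 0 \<Longrightarrow> n j * \<beta> j \<le> subdegree (\<psi> (semiroot (Suc j)))"
    show thesis
    proof (rule that[OF rel _ ex])
      show "n j * \<beta> j \<le> \<beta> (Suc j)" if "j < g" using le nz that by simp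
    qed (rule bound)
  qed
qed

lemma n_mult_beta_le: "j \<in> {1..<g} \<Longrightarrow> n j * \<beta> j \<le> \<beta> (Suc j)"
  using semiroot_or_equation_relation[of j] by auto

lemma value_semigroup_eq: "value_semigroup (branch_ring X Y) = Apery_hull"
  unfolding semigroup by (rule semigroup_eq_Apery_hull) (use semiroot_or_equation_relation in metis)

text \<open>The powers of \<open>z\<close> at the gaps form a basis of the quotient, and by symmetry
  half of the numbers below \<open>c\<close> are gaps.\<close>

lemma conductor: "2 * delta (branch_ring X Y) = c"
proof -
  let ?R = "branch_ring X Y"
  have "- Apery_hull \<subseteq> {..<c}"
  proof
    fix k assume "k \<in> - Apery_hull"
    hence "\<not> \<sigma> + 1 \<le> k + \<beta> 0" using Apery_hull_large by blast
    thus "k \<in> {..<c}" by (simp add: c_def)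
  qed
  hence fin: "finite (- value_semigroup ?R)"
    unfolding value_semigroup_eq by (rule finite_subset) simp
  have "h \<in> ?R" if "\<And>i. i < c \<Longrightarrow> fps_nth h i = 0" for h
    using large_expansion[OF that] by (metis \<psi>_def branch_ring_def rangeI)
  hence "quotient_basis ?R ((\<lambda>k. fps_X ^ k) ` (- value_semigroup ?R))"
    using quotient_basis_gaps fin by blast
  hence "delta ?R = card ((\<lambda>k. fps_X ^ k :: 'a fps) ` (- Apery_hull))"
    using delta_eq_card value_semigroup_eq by simp
  also have "\<dots> = card (- Apery_hull)"
    by (rule card_image) (rule inj_on_inverseI[where g = subdegree], simp)
  finally show ?thesis using card_gaps beta_0_le_sigma by (simp add: c_def)
qed

end

subsection \<open>The ideal of monomials beyond the conductor\<close>

context plane_branch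
begin

context
  fixes M :: "nat \<Rightarrow> 'a fps fps"
  assumes M: "\<And>k. k \<in> {c..<c + \<beta> 0} \<Longrightarrow> M k \<in> gen_monomials g f \<and> nu X Y (M k) = k"
begin

text \<open>\<open>M\<close> is an arbitrary choice of one monomial per value, so that the results
  hold for every choice.\<close>

abbreviation "J' \<equiv> ideal_gen (M ` {c..<c + \<beta> 0})"

text \<open>The chosen monomials have \<open>\<beta> 0\<close> consecutive values from
  \<open>c\<close> on, so \<open>fps_expansion\<close> reproduces the image of \<open>m\<close>; the
  difference lies in the kernel.\<close>

lemma monomial_decomposition:
  assumes m: "m \<in> gen_monomials g f" "c \<le> nu X Y m"
  obtains q u where "q \<in> J'" "m = q + u * fps_of_poly F"
proof -
  have "subst_xy X Y (M (c + k)) \<noteq> 0 \<and> subdegree (subst_xy X Y (M (c + k))) = c + k"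
    if "k < subdegree Y" for k
    using M[of "c + k"] monomial_nonzero[of "M (c + k)"] that beta_0 by (simp add: nu_def)
  moreover have "fps_nth (subst_xy X Y m) i = 0" if "i < c" for i
    using m(2) that by (intro nth_less_subdegree_zero) (simp add: nu_def)
  ultimately obtain a where a:
      "subst_xy X Y m = (\<Sum>k<subdegree Y. (a k oo Y) * subst_xy X Y (M (c + k)))"
    using fps_expansion[of Y "\<lambda>k. subst_xy X Y (M (c + k))" c "subst_xy X Y m"] subdegree_Y_pos
    by blast
  define q where "q = (\<Sum>k<subdegree Y. fps_const (a k) * M (c + k))"
  have "subst_xy X Y (m - q) = 0"
    by (simp add: q_def subst_xy_diff subst_xy_sum subst_xy_mult subst_xy_const a)
  then obtain u where "m - q = fps_of_poly F * u" using kernel_dvd by (metis dvdE)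
  moreover have "q \<in> J'"
    unfolding q_def using beta_0 by (intro ideal_gen_sum ideal_gen_mult ideal_gen_base) auto
  ultimately show ?thesis using that[of q u] by (simp add: algebra_simps)
qed

text \<open>The ideal \<open>J' + \<mm> F\<close>: a zero constant coefficient characterizes the
  maximal ideal. By Nakayama's argument it suffices to place \<open>F\<close> here.\<close>

definition L :: "'a fps fps set" where
  "L = {q + h * fps_of_poly F | q h. q \<in> J' \<and> fps_nth (fps_nth h 0) 0 = 0}"

lemma L_0: "0 \<in> L"
  unfolding L_def by (rule CollectI, rule exI[of _ 0], rule exI[of _ 0]) (simp add: ideal_gen_0)

lemma L_add:
  assumes "a \<in> L" "b \<in> L"
  shows "a + b \<in> L"
proof -
  obtain q h q' h' where "a = q + h * fps_of_poly F" "b = q' + h' * fps_of_poly F"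
      "q \<in> J'" "q' \<in> J'" "fps_nth (fps_nth h 0) 0 = 0" "fps_nth (fps_nth h' 0) 0 = 0"
    using assms unfolding L_def by blast
  thus ?thesis unfolding L_def
    by (intro CollectI exI[of _ "q + q'"] exI[of _ "h + h'"]) (simp add: ideal_gen_add algebra_simps)
qed

lemma L_mult:
  assumes "a \<in> L"
  shows "b * a \<in> L"
proof -
  obtain q h where "a = q + h * fps_of_poly F" "q \<in> J'" "fps_nth (fps_nth h 0) 0 = 0"
    using assms unfolding L_def by blast
  thus ?thesis unfolding L_def
    by (intro CollectI exI[of _ "b * q"] exI[of _ "b * h"]) (simp add: ideal_gen_mult algebra_simps)
qed

lemma L_sum: "(\<And>i. i \<in> A \<Longrightarrow> h i \<in> L) \<Longrightarrow> sum h A \<in> L"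
  by (induction A rule: infinite_finite_induct) (simp_all add: L_0 L_add)

text \<open>The factor \<open>t\<close> moves the uncontrolled cofactor of \<open>F\<close> into the
  maximal ideal.\<close>

lemma maximal_ideal_mult_monomial:
  assumes m: "m \<in> gen_monomials g f" "c \<le> nu X Y m" and t: "fps_nth (fps_nth t 0) 0 = 0"
  shows "t * m \<in> L"
proof -
  obtain q u where qu: "q \<in> J'" "m = q + u * fps_of_poly F"
    using monomial_decomposition[OF m] .
  have "t * m = t * q + (t * u) * fps_of_poly F" by (simp add: qu(2) algebra_simps)
  moreover have "t * q \<in> J'" using qu(1) by (rule ideal_gen_mult)
  moreover have "fps_nth (fps_nth (t * u) 0) 0 = 0" using t by simp
  ultimately show ?thesis unfolding L_def by blast
qed

section \<open>Substituting the semiroot relations into the equation\<close>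

lemma beta_1_pos: "\<beta> 1 > 0"
  using beta_0_less by simp

text \<open>The cofactor left when one factor of each \<open>f i ^ n i\<close> with
  \<open>i > j\<close> has been replaced by its relation:
  \<open>f j ^ n j * T j = f j * T (j - 1)\<close> for \<open>1 \<le> j \<le> g\<close>, and
  \<open>T g = 1\<close>.\<close>

definition T :: "nat \<Rightarrow> 'a fps poly" where "T j = (\<Prod>i\<in>{Suc j..g}. f i ^ (n i - 1))"

lemma T_monomial: "fps_of_poly (T j) \<in> gen_monomials g f"
  unfolding T_def fps_of_poly_prod fps_of_poly_power
  by (intro gen_monomials_prod gen_monomials_power gen_monomials_base) simp

lemma nu_T: "nu X Y (fps_of_poly (T j)) = (\<Sum>i\<in>{Suc j..g}. (n i - 1) * \<beta> i)"
proof -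
  define t where "t = (\<lambda>i. \<psi> (f i) ^ (n i - 1))"
  have t: "t i \<noteq> 0" "subdegree (t i) = (n i - 1) * \<beta> i" if "i \<in> {Suc j..g}" for i
    using subdegree_psi_f[of i] that by (simp_all add: t_def)
  have "nu X Y (fps_of_poly (T j)) = subdegree (\<Prod>i\<in>{Suc j..g}. t i)"
    using psi_prod[of "\<lambda>i. f i ^ (n i - 1)" "{Suc j..g}"]
    by (simp add: nu_def T_def \<psi>_def[symmetric] t_def psi_power)
  also have "\<dots> = (\<Sum>i\<in>{Suc j..g}. subdegree (t i))"
    by (rule subdegree_prod) (rule t)
  also have "\<dots> = (\<Sum>i\<in>{Suc j..g}. (n i - 1) * \<beta> i)" by (intro sum.cong refl t)
  finally show ?thesis .
qed

text \<open>By \<open>sum_bound\<close>, \<open>w r < n j * \<beta> j\<close>, so \<open>a\<close>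
  is divisible by \<open>y\<close>. One \<open>y\<close> is split off as multiplier from the maximal
  ideal; the monomial left has value at least \<open>\<sigma> + \<beta> 1 - \<beta> 0\<close>, hence
  at least \<open>c\<close>.\<close>

lemma term_mult_T_mem_L:
  assumes j: "j \<in> {1..g}" and r: "r < d (Suc j)"
    and a: "a \<noteq> 0" "n j * \<beta> j \<le> subdegree a * \<beta> 0 + w r"
  shows "fps_of_poly (smult a (P r) * T j) \<in> L"
proof -
  let ?S = "\<Sum>i\<in>{1..j}. (n i - 1) * \<beta> i"
  have bound: "?S + \<beta> 1 \<le> n j * \<beta> j" using sum_bound[OF n_mult_beta_le] j by simp
  have "w r \<le> ?S" using w_complement_gen[OF r] j by simp
  hence "subdegree a \<noteq> 0" using bound a(2) beta_1_pos by (cases "subdegree a = 0") simp_all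
  then obtain v where v: "subdegree a = Suc v" using not0_implies_Suc by blast
  define m where "m = fps_const (fps_X ^ v) * fps_of_poly (P r) * fps_of_poly (T j)"
  have mon: "m \<in> gen_monomials g f"
    unfolding m_def by (intro gen_monomials_mult y_power_monomial P_monomial T_monomial)
  have "nu X Y m = v * \<beta> 0 + w r + (\<Sum>i\<in>{Suc j..g}. (n i - 1) * \<beta> i)"
    unfolding m_def
    by (simp add: nu_mult monomial_nonzero gen_monomials_mult y_power_monomial P_monomial
        T_monomial nu_P nu_y_power nu_T)
  moreover have "\<sigma> = ?S + (\<Sum>i\<in>{Suc j..g}. (n i - 1) * \<beta> i)"
  proof -
    have "{1..g} = {1..j} \<union> {Suc j..g}" using j by auto
    thus ?thesis unfolding \<sigma>_def by (simp add: sum.union_disjoint)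
  qed
  ultimately have "c \<le> nu X Y m"
    using bound a(2) beta_1_pos v unfolding c_def by (simp add: algebra_simps)
  hence "fps_const fps_X * m \<in> L" using mon by (intro maximal_ideal_mult_monomial) simp_all
  hence "fps_const (fps_shift (Suc v) a) * (fps_const fps_X * m) \<in> L" by (rule L_mult)
  also have "fps_const (fps_shift (Suc v) a) * (fps_const fps_X * m)
      = fps_const (fps_shift (Suc v) a * fps_X ^ Suc v) * fps_of_poly (P r) * fps_of_poly (T j)"
    by (simp add: m_def mult_ac flip: fps_const_mult)
  also have "fps_shift (Suc v) a * fps_X ^ Suc v = a"
    using subdegree_decompose[of a] v by simp
  finally show ?thesis by (simp add: fps_of_poly_mult fps_of_poly_smult mult.assoc)
qed

text \<open>At \<open>j = 0\<close> the semiroot is \<open>x\<close>, in the maximal ideal, and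
  \<open>T 0\<close> has value \<open>\<sigma> \<ge> c\<close>. Each step multiplies the relation
  for the next semiroot by its cofactor; at \<open>j = g\<close> the product is \<open>F\<close>
  itself.\<close>

lemma semiroot_mult_T_mem_L:
  assumes "j \<le> g"
  shows "fps_of_poly (semiroot (Suc j) * T j) \<in> L"
  using assms
proof (induction j)
  case 0
  have "fps_of_poly (semiroot (Suc 0)) = fps_X"
    using f_1 g_pos by (simp add: semiroot_def)
  moreover have "nu X Y (fps_of_poly (T 0)) = \<sigma>" by (simp add: nu_T \<sigma>_def)
  hence "c \<le> nu X Y (fps_of_poly (T 0))" using beta_0_pos by (simp add: c_def)
  hence "fps_X * fps_of_poly (T 0) \<in> L"
    using T_monomial by (intro maximal_ideal_mult_monomial) simp_all
  ultimately show ?case by (simp only: fps_of_poly_mult)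
next
  case (Suc j)
  let ?i = "Suc j"
  have i: "?i \<in> {1..g}" using Suc.prems by simp
  show ?case
  proof (rule semiroot_or_equation_relation[OF i])
    fix a
    assume rel: "semiroot (Suc ?i) = f ?i ^ n ?i + (\<Sum>r<d (Suc ?i). smult (a r) (P r))"
      and bound: "\<And>r. r < d (Suc ?i) \<Longrightarrow> a r \<noteq> 0 \<Longrightarrow>
        n ?i * \<beta> ?i \<le> subdegree (a r) * \<beta> 0 + w r"
    have "{Suc j..g} = insert ?i {Suc ?i..g}" using i by auto
    hence "T j = f ?i ^ (n ?i - 1) * T ?i" by (simp add: T_def)
    hence "f ?i ^ n ?i * T ?i = semiroot ?i * T j"
      using n_pos[OF i] i by (simp add: semiroot_def power_eq_if)
    hence "fps_of_poly (f ?i ^ n ?i * T ?i) \<in> L" using Suc by simp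
    moreover have "(\<Sum>r<d (Suc ?i). fps_of_poly (smult (a r) (P r) * T ?i)) \<in> L"
    proof (rule L_sum)
      fix r assume r: "r \<in> {..<d (Suc ?i)}"
      show "fps_of_poly (smult (a r) (P r) * T ?i) \<in> L"
      proof (cases "a r = 0")
        case False
        thus ?thesis using term_mult_T_mem_L[OF i] bound r by simp
      qed (simp add: L_0)
    qed
    ultimately have "fps_of_poly (f ?i ^ n ?i * T ?i)
        + (\<Sum>r<d (Suc ?i). fps_of_poly (smult (a r) (P r) * T ?i)) \<in> L"
      by (rule L_add)
    thus ?thesis
      by (simp only: rel distrib_right sum_distrib_right fps_of_poly_add fps_of_poly_sum)
  qed
qed

text \<open>\<open>F\<close> lies in \<open>J' + \<mm>F\<close>, where \<open>\<mm>\<close> is the maximal ideal, and \<open>1 - h\<close> is a unit for \<open>h \<in> \<mm>\<close>.\<close>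
lemma equation_mem: "fps_of_poly F \<in> J'"
proof -
  have "fps_of_poly F \<in> L"
    using semiroot_mult_T_mem_L[of g] by (simp add: semiroot_def T_def)
  then obtain q h where q: "fps_of_poly F = q + h * fps_of_poly F" "q \<in> J'"
      and h: "fps_nth (fps_nth h 0) 0 = 0"
    unfolding L_def by blast
  \<comment> \<open>Inversion in two stages: the coefficient of \<open>x ^ 0\<close> has constant
    term \<open>1\<close>, so it is a unit among the series in \<open>y\<close>, and therefore
    \<open>1 - h\<close> is a unit.\<close>
  have "fps_nth (1 - h) 0 * inverse (fps_nth (1 - h) 0) = 1"
    using h by (intro inverse_mult_eq_1') simp
  from fps_right_inverse[OF this] obtain v where v: "(1 - h) * v = 1" by blast
  have "q = fps_of_poly F - h * fps_of_poly F" using q(1) by (metis add_diff_cancel_right')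
  hence "v * q = v * (fps_of_poly F - h * fps_of_poly F)" by (rule arg_cong)
  also have "\<dots> = ((1 - h) * v) * fps_of_poly F" by (simp add: algebra_simps)
  also have "\<dots> = fps_of_poly F" using v by simp
  finally show ?thesis using ideal_gen_mult[OF q(2), of v] by simp
qed

text \<open>With \<open>F\<close> in \<open>J'\<close>, both summands of
  \<open>monomial_decomposition\<close> lie in \<open>J'\<close>.\<close>

lemma ideal_eq: "J' = ideal_gen {m \<in> gen_monomials g f. c \<le> nu X Y m}"
proof (rule antisym; rule ideal_gen_subset)
  show "M ` {c..<c + \<beta> 0} \<subseteq> ideal_gen {m \<in> gen_monomials g f. c \<le> nu X Y m}"
    using M by (auto intro!: ideal_gen_base)
  show "{m \<in> gen_monomials g f. c \<le> nu X Y m} \<subseteq> J'"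
  proof
    fix m assume "m \<in> {m \<in> gen_monomials g f. c \<le> nu X Y m}"
    then obtain q u where "q \<in> J'" "m = q + u * fps_of_poly F"
      using monomial_decomposition by blast
    thus "m \<in> J'" using equation_mem by (simp add: ideal_gen_add ideal_gen_mult)
  qed
qed

end
end

theorem theoremC2:
  fixes X Y :: "'a::field fps"
    and F :: "'a fps poly"
    and g :: nat
    and \<beta> :: "nat \<Rightarrow> nat"
    and f :: "nat \<Rightarrow> 'a fps poly"
  defines "R \<equiv> branch_ring X Y"
  defines "\<delta> \<equiv> delta R"
  defines "J \<equiv> ideal_gen {m \<in> gen_monomials g f. nu X Y m \<ge> 2 * \<delta>}"
  defines "I \<equiv> {2 * \<delta>..<2 * \<delta> + subdegree Y}"
  assumes "fps_nth X 0 = 0" and "fps_nth Y 0 = 0"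
    and "fraction_field_of R = UNIV"
    and "monic_weierstrass F"
    and "{h. subst_xy X Y h = 0} = ideal_gen {fps_of_poly F}"
    and "g \<ge> 1"
    and "characteristic_generators (value_semigroup R) g \<beta>"
    and "\<beta> 0 = subdegree Y" and "\<beta> 1 = subdegree X"
    and "semiroot_system X Y g \<beta> f"
    and "CHAR('a) > 0 \<Longrightarrow> gcd CHAR('a) (\<Prod>i\<in>{1..g}. char_n \<beta> i) = 1"
  shows "fps_of_poly F \<in> J \<and>
         (\<forall>k\<in>I. \<exists>m\<in>gen_monomials g f. nu X Y m = k) \<and>
         (\<forall>m. (\<forall>k\<in>I. m k \<in> gen_monomials g f \<and> nu X Y (m k) = k) \<longrightarrow> ideal_gen (m ` I) = J)"
proof -
  interpret char_seq g \<beta>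
    using assms(10,11) by unfold_locales (auto simp: characteristic_generators_def)
  interpret plane_branch X Y g \<beta> f F
  proof unfold_locales
    show "\<beta> 0 < \<beta> 1"
      using assms(10,11) strict_mono_onD[of "{..g}" \<beta> 0 1]
      by (simp add: characteristic_generators_def)
    show "value_semigroup (branch_ring X Y) = range (\<lambda>c :: nat \<Rightarrow> nat. \<Sum>i\<le>g. c i * \<beta> i)"
      using assms(11) unfolding characteristic_generators_def R_def by blast
    show "lead_coeff (f i) = 1" "nu X Y (fps_of_poly (f i)) = \<beta> i" if "i \<in> {1..g}" for i
      using assms(14) that unfolding semiroot_system_def by blast+
    show "degree (f i) = d i" if "i \<in> {1..g}" for i
      using assms(14) that by (simp add: semiroot_system_def d_def)
  qed (use assms in \<open>simp_all add: semiroot_system_def\<close>)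
  have c: "2 * \<delta> = c" unfolding \<delta>_def R_def by (rule conductor)
  have I: "I = {c..<c + \<beta> 0}" unfolding I_def c beta_0 ..
  have J: "J = ideal_gen {m \<in> gen_monomials g f. c \<le> nu X Y m}" unfolding J_def c ..
  have ex: "\<forall>k\<in>I. \<exists>m\<in>gen_monomials g f. nu X Y m = k"
    using monomial_of_large_value by (auto simp: I)
  \<comment> \<open>One choice suffices for the membership of \<open>F\<close>; the last claim
    applies \<open>ideal_eq\<close> to every choice.\<close>
  then obtain M where M: "\<And>k. k \<in> I \<Longrightarrow> M k \<in> gen_monomials g f \<and> nu X Y (M k) = k" by metis
  have "fps_of_poly F \<in> J"
    using equation_mem[OF M] ideal_eq[OF M] unfolding I J by simp
  moreover have "ideal_gen (m ` I) = J"
    if "\<forall>k\<in>I. m k \<in> gen_monomials g f \<and> nu X Y (m k) = k" for m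
    using ideal_eq[of m] that unfolding I J by blast
  ultimately show ?thesis using ex by blast
qed

end
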